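(* Let $X$ and $B$ be smooth affine algebraic varieties over $\mathbb{C}$ and let $\pi:X\to B$ be a Zariski locally trivial fibration with fiber $Y$ admitting a nontrivial locally nilpotent vector field $\delta$. Let $\alpha_1,\dots,\alpha_k$ be regular functions on $B$ without common zeros such that, for each $i$, $X_i:=X\setminus(\alpha_i\circ\pi)^{-1}(0)$ is naturally isomorphic (over $B_i$) to the direct product $B_i\times Y$, where $B_i=B\setminus\alpha_i^{-1}(0)$. Suppose that $\xi_1,\dots,\xi_k$ are locally nilpotent vector fields on $X$ such that for each $i$: (i) $\xi_i(\mathbb{C}[B])\subset\mathbb{C}[B]$, i.e. $\xi_i$ induces a locally nilpotent vector field $\xi_i'$ on $B$; (ii) $\alpha_i\in\operatorname{Ker}\xi_i'$, i.e. $\xi_i'$ is locally nilpotent on $B_i$; (iii) $\xi_i'$ admits a slice on $B_i$, that is, $B_i$ is isomorphic to $R_i\times\mathbb{C}$ for some variety $R_i$ so that the $\mathbb{C}_+$-action generated by $\xi_i'$ is the translation on the second factor (in particular $\xi_i'$ is nontrivial). Then there exist a nontrivial locally nilpotent vector field $\eta$ on $X$ and a nontrivial (i.e. nonzero) ideal $J\subset\mathbb{C}[X]$ for which $J\eta\subset\mathrm{Lie}_{alg}(X)$.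
   Context: All varieties are irreducible; $\mathbb{C}[B]$ is regarded as a subring of $\mathbb{C}[X]$ via $\pi^*$. An algebraic vector field is identified with the corresponding derivation of the ring of regular functions and $\operatorname{Ker}$ denotes its kernel. A vector field is complete if it is generated by a holomorphic $\mathbb{C}_+$-action; it is locally nilpotent if it is generated by an algebraic $\mathbb{C}_+$-action. $\mathrm{Lie}_{alg}(X)$ is the Lie algebra generated by all complete algebraic vector fields on $X$. *)

theory Defs
  imports "HOL-Analysis.Analysis" "HOL-Algebra.Ideal"
begin

section \<open>Affine varieties and regular functions\<close>

inductive polynomial_fun :: "(complex ^ 'n \<Rightarrow> complex) \<Rightarrow> bool" where
  const: "polynomial_fun (\<lambda>_. c)"
| coord: "polynomial_fun (\<lambda>x. x $ i)"
| add: "polynomial_fun p \<Longrightarrow> polynomial_fun q \<Longrightarrow> polynomial_fun (\<lambda>x. p x + q x)"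
| mult: "polynomial_fun p \<Longrightarrow> polynomial_fun q \<Longrightarrow> polynomial_fun (\<lambda>x. p x * q x)"

definition zariski :: "(complex ^ 'n) topology" where
  "zariski = topology_generated_by {{x. p x \<noteq> 0} | p. polynomial_fun p}"

definition zariski_irreducible :: "(complex ^ 'n) set \<Rightarrow> bool" where
  "zariski_irreducible S \<longleftrightarrow> S \<noteq> {} \<and>
     (\<forall>C D. closedin zariski C \<and> closedin zariski D \<and> S \<subseteq> C \<union> D \<longrightarrow> S \<subseteq> C \<or> S \<subseteq> D)"

definition affine_variety :: "(complex ^ 'n) set \<Rightarrow> bool" where
  "affine_variety X \<longleftrightarrow> closedin zariski X \<and> zariski_irreducible X"

text \<open>The set \<open>S\<close> is meant to be a Zariski-open subset of an affine variety; regularity is then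
  the usual local condition.\<close>

definition regular_on :: "(complex ^ 'n) set \<Rightarrow> (complex ^ 'n \<Rightarrow> complex) \<Rightarrow> bool" where
  "regular_on S f \<longleftrightarrow> (\<forall>x\<in>S. \<exists>U p q. openin zariski U \<and> x \<in> U \<and>
     polynomial_fun p \<and> polynomial_fun q \<and> (\<forall>y\<in>S \<inter> U. q y \<noteq> 0 \<and> f y = p y / q y))"

text \<open>The regular functions on \<open>X\<close>, represented by functions on the ambient affine space
  that are \<open>0\<close> outside \<open>X\<close>, so that equality of regular functions is equality in HOL.\<close>

definition regular_funs :: "(complex ^ 'n) set \<Rightarrow> (complex ^ 'n \<Rightarrow> complex) set" where
  "regular_funs X = {f. regular_on X f \<and> (\<forall>x. x \<notin> X \<longrightarrow> f x = 0)}"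

definition coord_ring :: "(complex ^ 'n) set \<Rightarrow> (complex ^ 'n \<Rightarrow> complex) ring" where
  "coord_ring X = \<lparr>carrier = regular_funs X, mult = (\<lambda>f g x. f x * g x),
     one = (\<lambda>x. if x \<in> X then 1 else 0), zero = (\<lambda>_. 0), add = (\<lambda>f g x. f x + g x)\<rparr>"

definition regular_map ::
  "(complex ^ 'n) set \<Rightarrow> (complex ^ 'm) set \<Rightarrow> (complex ^ 'n \<Rightarrow> complex ^ 'm) \<Rightarrow> bool" where
  "regular_map S T \<phi> \<longleftrightarrow> \<phi> ` S \<subseteq> T \<and> (\<forall>j. regular_on S (\<lambda>x. \<phi> x $ j))"

definition alg_isomorphism ::
  "(complex ^ 'n) set \<Rightarrow> (complex ^ 'm) set \<Rightarrow> (complex ^ 'n \<Rightarrow> complex ^ 'm) \<Rightarrow> bool" where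
  "alg_isomorphism S T \<phi> \<longleftrightarrow> regular_map S T \<phi> \<and>
     (\<exists>\<psi>. regular_map T S \<psi> \<and> (\<forall>x\<in>S. \<psi> (\<phi> x) = x) \<and> (\<forall>y\<in>T. \<phi> (\<psi> y) = y))"

definition pullback :: "(complex ^ 'n) set \<Rightarrow> (complex ^ 'n \<Rightarrow> complex ^ 'm) \<Rightarrow>
    (complex ^ 'm \<Rightarrow> complex) \<Rightarrow> (complex ^ 'n \<Rightarrow> complex)" where
  "pullback X \<pi> f = (\<lambda>x. if x \<in> X then f (\<pi> x) else 0)"

text \<open>\<open>\<complex>\<^sup>m \<times> \<complex>\<^sup>n\<close> is realised as the affine space whose coordinates are indexed by \<open>'m + 'n\<close>.\<close>

definition join :: "complex ^ 'm \<Rightarrow> complex ^ 'n \<Rightarrow> complex ^ ('m::finite + 'n::finite)" where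
  "join x y = (\<chi> i. case i of Inl a \<Rightarrow> x $ a | Inr b \<Rightarrow> y $ b)"

definition proj1 :: "complex ^ ('m::finite + 'n::finite) \<Rightarrow> complex ^ 'm" where
  "proj1 z = (\<chi> a. z $ Inl a)"

definition proj2 :: "complex ^ ('m::finite + 'n::finite) \<Rightarrow> complex ^ 'n" where
  "proj2 z = (\<chi> b. z $ Inr b)"

definition direct_product ::
  "(complex ^ 'm) set \<Rightarrow> (complex ^ 'n) set \<Rightarrow> (complex ^ ('m::finite + 'n::finite)) set" where
  "direct_product S T = {join x y | x y. x \<in> S \<and> y \<in> T}"

abbreviation affine_line :: "(complex ^ 1) set" where
  "affine_line \<equiv> UNIV"


section \<open>Smoothness\<close>

text \<open>Krull dimension: the maximal length of a chain of irreducible closed subsets.\<close>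

definition variety_dim :: "(complex ^ 'n) set \<Rightarrow> nat" where
  "variety_dim X = Sup {d. \<exists>Z :: nat \<Rightarrow> (complex ^ 'n) set.
     (\<forall>i\<le>d. affine_variety (Z i) \<and> Z i \<subseteq> X) \<and> (\<forall>i<d. Z i \<subset> Z (Suc i))}"

definition tangent_space :: "(complex ^ 'n) set \<Rightarrow> complex ^ 'n \<Rightarrow> (complex ^ 'n) set" where
  "tangent_space X x = {v. \<forall>p. polynomial_fun p \<and> (\<forall>y\<in>X. p y = 0) \<longrightarrow>
     deriv (\<lambda>t. p (x + t *s v)) 0 = 0}"

definition smooth_affine_variety :: "(complex ^ 'n) set \<Rightarrow> bool" where
  "smooth_affine_variety X \<longleftrightarrow> affine_variety X \<and>
     (\<forall>x\<in>X. vec.dim (tangent_space X x) = variety_dim X)"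


section \<open>Fibrations\<close>

definition trivial_over :: "(complex ^ 'n) set \<Rightarrow> (complex ^ 'n \<Rightarrow> complex ^ 'm) \<Rightarrow>
    (complex ^ 'm) set \<Rightarrow> (complex ^ 'p) set \<Rightarrow> bool" where
  "trivial_over X \<pi> U Y \<longleftrightarrow> (\<exists>\<phi>. alg_isomorphism {x\<in>X. \<pi> x \<in> U} (direct_product U Y) \<phi> \<and>
     (\<forall>x\<in>X. \<pi> x \<in> U \<longrightarrow> proj1 (\<phi> x) = \<pi> x))"

definition zariski_locally_trivial :: "(complex ^ 'n) set \<Rightarrow> (complex ^ 'm) set \<Rightarrow>
    (complex ^ 'n \<Rightarrow> complex ^ 'm) \<Rightarrow> (complex ^ 'p) set \<Rightarrow> bool" where
  "zariski_locally_trivial X B \<pi> Y \<longleftrightarrow> regular_map X B \<pi> \<and>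
     (\<forall>b\<in>B. \<exists>U. openin (subtopology zariski B) U \<and> b \<in> U \<and> trivial_over X \<pi> U Y)"


section \<open>Vector fields\<close>

type_synonym 'n field_op = "(complex ^ 'n \<Rightarrow> complex) \<Rightarrow> (complex ^ 'n \<Rightarrow> complex)"

text \<open>Derivations of the ring of regular functions, extended by \<open>0\<close> to all other arguments, so
  that equality of vector fields is equality in HOL.\<close>

definition alg_vector_field :: "(complex ^ 'n) set \<Rightarrow> 'n field_op \<Rightarrow> bool" where
  "alg_vector_field X D \<longleftrightarrow>
     (\<forall>f. f \<notin> regular_funs X \<longrightarrow> D f = (\<lambda>_. 0)) \<and>
     (\<forall>f\<in>regular_funs X. D f \<in> regular_funs X) \<and>
     (\<forall>f\<in>regular_funs X. \<forall>g\<in>regular_funs X. D (\<lambda>x. f x + g x) = (\<lambda>x. D f x + D g x)) \<and>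
     (\<forall>c. \<forall>f\<in>regular_funs X. D (\<lambda>x. c * f x) = (\<lambda>x. c * D f x)) \<and>
     (\<forall>f\<in>regular_funs X. \<forall>g\<in>regular_funs X. D (\<lambda>x. f x * g x) = (\<lambda>x. f x * D g x + g x * D f x))"

definition zero_field :: "'n::finite field_op" where
  "zero_field = (\<lambda>_ _. 0)"

definition field_kernel :: "(complex ^ 'n) set \<Rightarrow> 'n field_op \<Rightarrow> (complex ^ 'n \<Rightarrow> complex) set" where
  "field_kernel X D = {f \<in> regular_funs X. D f = (\<lambda>_. 0)}"

text \<open>Algebraic and holomorphic actions of the additive group \<open>\<complex>\<^sub>+\<close>; the action map is regarded as
  a map on the direct product of the affine line with the set acted upon.\<close>

definition action_map :: "(complex \<Rightarrow> complex ^ 'n \<Rightarrow> complex ^ 'n) \<Rightarrow> complex ^ (1 + 'n::finite) \<Rightarrow> complex ^ 'n" where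
  "action_map \<Phi> z = \<Phi> (proj1 z $ 1) (proj2 z)"

definition additive_action ::
  "(complex ^ 'n) set \<Rightarrow> (complex \<Rightarrow> complex ^ 'n \<Rightarrow> complex ^ 'n) \<Rightarrow> bool" where
  "additive_action S \<Phi> \<longleftrightarrow> (\<forall>t. \<forall>x\<in>S. \<Phi> t x \<in> S) \<and> (\<forall>x\<in>S. \<Phi> 0 x = x) \<and>
     (\<forall>s t. \<forall>x\<in>S. \<Phi> (s + t) x = \<Phi> s (\<Phi> t x))"

definition algebraic_action ::
  "(complex ^ 'n) set \<Rightarrow> (complex \<Rightarrow> complex ^ 'n \<Rightarrow> complex ^ 'n) \<Rightarrow> bool" where
  "algebraic_action S \<Phi> \<longleftrightarrow> additive_action S \<Phi> \<and>
     regular_map (direct_product affine_line S) S (action_map \<Phi>)"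

definition holomorphic_open :: "(complex ^ 'n) set \<Rightarrow> (complex ^ 'n \<Rightarrow> complex) \<Rightarrow> bool" where
  "holomorphic_open U F \<longleftrightarrow> open U \<and>
     (\<forall>x\<in>U. \<exists>L. (F has_derivative L) (at x) \<and> (\<forall>c v. L (c *s v) = c * L v))"

text \<open>Holomorphic functions on a closed analytic subset are those that extend holomorphically
  to the ambient space near every point.\<close>

definition holomorphic_map ::
  "(complex ^ 'n) set \<Rightarrow> (complex ^ 'm) set \<Rightarrow> (complex ^ 'n \<Rightarrow> complex ^ 'm) \<Rightarrow> bool" where
  "holomorphic_map S T \<phi> \<longleftrightarrow> \<phi> ` S \<subseteq> T \<and>
     (\<forall>j. \<forall>x\<in>S. \<exists>U F. x \<in> U \<and> holomorphic_open U F \<and> (\<forall>y\<in>S \<inter> U. \<phi> y $ j = F y))"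

definition holomorphic_action ::
  "(complex ^ 'n) set \<Rightarrow> (complex \<Rightarrow> complex ^ 'n \<Rightarrow> complex ^ 'n) \<Rightarrow> bool" where
  "holomorphic_action S \<Phi> \<longleftrightarrow> additive_action S \<Phi> \<and>
     holomorphic_map (direct_product affine_line S) S (action_map \<Phi>)"

text \<open>The action \<open>\<Phi>\<close> on \<open>S\<close> is generated by the restriction to \<open>S\<close> of the vector field \<open>D\<close> on \<open>X\<close>,
  where \<open>S\<close> is a Zariski-open subset of \<open>X\<close> (possibly \<open>X\<close> itself). Testing against the regular
  functions on \<open>X\<close> suffices, since they include the coordinates.\<close>

definition generates :: "(complex ^ 'n) set \<Rightarrow> 'n field_op \<Rightarrow> (complex ^ 'n) set \<Rightarrow>
    (complex \<Rightarrow> complex ^ 'n \<Rightarrow> complex ^ 'n) \<Rightarrow> bool" where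
  "generates X D S \<Phi> \<longleftrightarrow> (\<forall>f\<in>regular_funs X. \<forall>x\<in>S.
     ((\<lambda>t. f (\<Phi> t x)) has_field_derivative D f x) (at 0))"

definition complete_field :: "(complex ^ 'n) set \<Rightarrow> 'n field_op \<Rightarrow> bool" where
  "complete_field X D \<longleftrightarrow> alg_vector_field X D \<and>
     (\<exists>\<Phi>. holomorphic_action X \<Phi> \<and> generates X D X \<Phi>)"

definition locally_nilpotent_field :: "(complex ^ 'n) set \<Rightarrow> 'n field_op \<Rightarrow> bool" where
  "locally_nilpotent_field X D \<longleftrightarrow> alg_vector_field X D \<and>
     (\<exists>\<Phi>. algebraic_action X \<Phi> \<and> generates X D X \<Phi>)"

inductive_set Lie_alg :: "(complex ^ 'n) set \<Rightarrow> 'n field_op set" for X where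
  complete: "complete_field X D \<Longrightarrow> D \<in> Lie_alg X"
| add: "D \<in> Lie_alg X \<Longrightarrow> E \<in> Lie_alg X \<Longrightarrow> (\<lambda>f x. D f x + E f x) \<in> Lie_alg X"
| scale: "D \<in> Lie_alg X \<Longrightarrow> (\<lambda>f x. c * D f x) \<in> Lie_alg X"
| bracket: "D \<in> Lie_alg X \<Longrightarrow> E \<in> Lie_alg X \<Longrightarrow> (\<lambda>f x. D (E f) x - E (D f) x) \<in> Lie_alg X"

text \<open>The field on \<open>B\<close> induced by a field \<open>D\<close> on \<open>X\<close> that preserves the image of the (injective,
  for surjective \<open>\<pi>\<close>) pullback map.\<close>

definition induced_field :: "(complex ^ 'n) set \<Rightarrow> (complex ^ 'm) set \<Rightarrow>
    (complex ^ 'n \<Rightarrow> complex ^ 'm) \<Rightarrow> 'n field_op \<Rightarrow> 'm field_op" where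
  "induced_field X B \<pi> D = (\<lambda>f. if f \<in> regular_funs B
     then inv_into (regular_funs B) (pullback X \<pi>) (D (pullback X \<pi> f)) else (\<lambda>_. 0))"

text \<open>\<open>D\<close> is a vector field on \<open>B\<close>, \<open>U\<close> is an open subset of \<open>B\<close>, and the action generated by \<open>D\<close>
  on \<open>U\<close> becomes translation on the second factor under \<open>U \<cong> R \<times> \<complex>\<close>.\<close>

definition admits_slice :: "(complex ^ 'm) set \<Rightarrow> 'm field_op \<Rightarrow> (complex ^ 'm) set \<Rightarrow>
    (complex ^ 'r) set \<Rightarrow> bool" where
  "admits_slice B D U R \<longleftrightarrow> (\<exists>\<psi> \<Phi>. alg_isomorphism U (direct_product R affine_line) \<psi> \<and>
     algebraic_action U \<Phi> \<and> generates B D U \<Phi> \<and>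
     (\<forall>t. \<forall>b\<in>U. \<psi> (\<Phi> t b) = join (proj1 (\<psi> b)) (proj2 (\<psi> b) + vec t)))"

end

theory Submission
  imports Defs "HOL-Computational_Algebra.Fundamental_Theorem_Algebra" "HOL-Library.Countable"
    "HOL-Complex_Analysis.Cauchy_Integral_Formula"
begin

text \<open>Extending \<open>\<delta>\<close> to some nonempty \<open>B\<^sub>j \<times> Y\<close> and multiplying by a power of \<open>\<alpha>\<^sub>j\<close> gives a
  locally nilpotent field \<open>\<eta>\<close> on \<open>X\<close> that vanishes on \<open>\<complex>[B]\<close>. The slice on \<open>B\<^sub>i\<close> yields \<open>a \<in> \<complex>[B]\<close> with
  \<open>\<xi>\<^sub>i a = \<alpha>\<^sub>i\<^sup>N \<in> Ker \<xi>\<^sub>i\<close>, so for \<open>f \<in> Ker \<xi>\<^sub>i\<close> and \<open>g \<in> \<complex>[B]\<close> the fields \<open>f \<xi>\<^sub>i\<close>, \<open>a f \<xi>\<^sub>i\<close>,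
  \<open>g \<eta>\<close>, \<open>a g \<eta>\<close> are complete and \<open>[f \<xi>\<^sub>i, a g \<eta>] - [a f \<xi>\<^sub>i, g \<eta>] = \<alpha>\<^sub>i\<^sup>N f g \<eta>\<close>.
  Since \<open>\<complex>[X\<^sub>i]\<close> is generated by \<open>\<xi>\<^sub>i\<close>-invariants and \<open>a / \<alpha>\<^sub>i\<^sup>N\<close>, every \<open>f \<in> \<complex>[X]\<close> satisfies
  \<open>h \<alpha>\<^sub>i\<^sup>n f \<eta> \<in> Lie\<^sub>a\<^sub>l\<^sub>g\<close> for all \<open>h \<in> \<complex>[B]\<close> and some \<open>n\<close> depending on \<open>f\<close> and \<open>i\<close>. The
  \<open>\<alpha>\<^sub>i\<close> having no common zeros, a partition of unity on \<open>B\<close> gives \<open>f \<eta> \<in> Lie\<^sub>a\<^sub>l\<^sub>g\<close>, so that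
  \<open>J = \<complex>[X]\<close> works.\<close>

section \<open>Polynomial functions\<close>

lemma polynomial_fun_uminus: "polynomial_fun p \<Longrightarrow> polynomial_fun (\<lambda>x. - p x)"
  using polynomial_fun.mult[OF polynomial_fun.const[of "-1"], of p] by simp

lemma polynomial_fun_diff:
  "polynomial_fun p \<Longrightarrow> polynomial_fun q \<Longrightarrow> polynomial_fun (\<lambda>x. p x - q x)"
  using polynomial_fun.add[OF _ polynomial_fun_uminus, of p q] by simp

lemma polynomial_fun_power: "polynomial_fun p \<Longrightarrow> polynomial_fun (\<lambda>x. p x ^ n)"
  by (induction n) (auto intro: polynomial_fun.intros)

lemma polynomial_fun_sum:
  "(\<And>i. i \<in> I \<Longrightarrow> polynomial_fun (p i)) \<Longrightarrow> polynomial_fun (\<lambda>x. \<Sum>i\<in>I. p i x)"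
  by (induction I rule: infinite_finite_induct) (auto intro: polynomial_fun.intros)

lemma polynomial_fun_prod:
  "(\<And>i. i \<in> I \<Longrightarrow> polynomial_fun (p i)) \<Longrightarrow> polynomial_fun (\<lambda>x. \<Prod>i\<in>I. p i x)"
  by (induction I rule: infinite_finite_induct) (auto intro: polynomial_fun.intros)

lemma polynomial_fun_poly: "polynomial_fun p \<Longrightarrow> polynomial_fun (\<lambda>x. poly q (p x))"
  by (induction q) (auto intro: polynomial_fun.intros)

lemma polynomial_fun_comp:
  assumes "polynomial_fun p" "\<And>j. polynomial_fun (\<lambda>x. G x $ j)"
  shows "polynomial_fun (\<lambda>x. p (G x))"
  using assms(1) by induction (auto intro: polynomial_fun.intros assms(2))


section \<open>Nullstellensatz\<close>

definition word_monomial :: "nat \<Rightarrow> complex ^ 'n::finite \<Rightarrow> complex" where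
  "word_monomial i x = prod_list (map (($) x) (from_nat i :: 'n list))"

text \<open>The bound \<open>d\<close> is on indices in the enumeration of words, not on the degree:
  polynomials with a common \<open>d\<close> lie in one space spanned by \<open>d\<close>
  functions.\<close>

definition monomial_combination :: "nat \<Rightarrow> (complex ^ 'n::finite \<Rightarrow> complex) \<Rightarrow> bool" where
  "monomial_combination d p \<longleftrightarrow> (\<exists>c. p = (\<lambda>x. \<Sum>i<d. c i * word_monomial i x))"

lemma monomial_combination_mono:
  assumes "monomial_combination d p" "d \<le> e"
  shows "monomial_combination e p"
proof -
  obtain c where c: "p = (\<lambda>x. \<Sum>i<d. c i * word_monomial i x)"
    using assms unfolding monomial_combination_def by blast
  have "(\<Sum>i<d. c i * word_monomial i x) = (\<Sum>i<e. (if i < d then c i else 0) * word_monomial i x)"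
    for x :: "complex ^ 'n"
    by (rule sum.mono_neutral_cong_left) (use assms(2) in auto)
  then show ?thesis unfolding monomial_combination_def c
    by (intro exI[of _ "\<lambda>i. if i < d then c i else 0"]) auto
qed

lemma monomial_combination_add:
  assumes "\<exists>d. monomial_combination d p" "\<exists>d. monomial_combination d q"
  shows "\<exists>d. monomial_combination d (\<lambda>x. p x + q x)"
proof -
  obtain d e where "monomial_combination d p" "monomial_combination e q" using assms by blast
  then have "monomial_combination (max d e) p" "monomial_combination (max d e) q"
    by (auto elim: monomial_combination_mono)
  then obtain b c where "p = (\<lambda>x. \<Sum>i<max d e. b i * word_monomial i x)"
      "q = (\<lambda>x. \<Sum>i<max d e. c i * word_monomial i x)"
    unfolding monomial_combination_def by blast
  then have "monomial_combination (max d e) (\<lambda>x. p x + q x)"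
    unfolding monomial_combination_def
    by (intro exI[of _ "\<lambda>i. b i + c i"]) (auto simp: sum.distrib distrib_right)
  then show ?thesis by blast
qed

lemma monomial_combination_scale:
  assumes "\<exists>d. monomial_combination d p"
  shows "\<exists>d. monomial_combination d (\<lambda>x. a * p x)"
proof -
  obtain d c where c: "p = (\<lambda>x. \<Sum>i<d. c i * word_monomial i x)"
    using assms unfolding monomial_combination_def by blast
  have "monomial_combination d (\<lambda>x. a * p x)"
    unfolding monomial_combination_def c
    by (intro exI[of _ "\<lambda>i. a * c i"]) (auto simp: sum_distrib_left mult.assoc)
  then show ?thesis by blast
qed

lemma monomial_combination_sum:
  assumes "\<And>i. i \<in> I \<Longrightarrow> \<exists>d. monomial_combination d (p i)"
  shows "\<exists>d. monomial_combination d (\<lambda>x. \<Sum>i\<in>I. p i x)"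
proof -
  have z: "\<exists>d. monomial_combination d (\<lambda>x. 0)"
    unfolding monomial_combination_def by (intro exI[of _ 0]) auto
  show ?thesis using assms
    by (induction I rule: infinite_finite_induct) (auto intro: z monomial_combination_add)
qed

lemma monomial_combination_word: "\<exists>d. monomial_combination d (\<lambda>x. prod_list (map (($) x) w))"
proof -
  let ?k = "to_nat w"
  have "(\<Sum>i<Suc ?k. (if i = ?k then 1 else 0) * word_monomial i x) = prod_list (map (($) x) w)" for x
    by (simp add: word_monomial_def)
  then have "monomial_combination (Suc ?k) (\<lambda>x. prod_list (map (($) x) w))"
    unfolding monomial_combination_def by (intro exI[of _ "\<lambda>i. if i = ?k then 1 else 0"]) auto
  then show ?thesis by blast
qed

lemma polynomial_fun_monomial_combination:
  fixes p :: "complex ^ 'n::finite \<Rightarrow> complex"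
  shows "polynomial_fun p \<Longrightarrow> \<exists>d. monomial_combination d p"
proof (induction rule: polynomial_fun.induct)
  case (const c)
  show ?case using monomial_combination_scale[OF monomial_combination_word[of "[]"], of c] by simp
next
  case (coord i)
  show ?case using monomial_combination_word[of "[i]"] by simp
next
  case (add p q)
  then show ?case using monomial_combination_add by blast
next
  case (mult p q)
  then obtain d e b c where p: "p = (\<lambda>x. \<Sum>i<d. b i * word_monomial i x)"
      and q: "q = (\<lambda>x. \<Sum>i<e. c i * word_monomial i x)"
    unfolding monomial_combination_def by blast
  \<comment> \<open>The product of two word monomials belongs to the concatenated word.\<close>
  have W: "\<exists>d. monomial_combination d (\<lambda>x :: complex ^ 'n. word_monomial i x * word_monomial j x)" for i j
    using monomial_combination_word[of "from_nat i @ from_nat j"] by (simp add: word_monomial_def)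
  have "\<exists>m. monomial_combination m
      (\<lambda>x :: complex ^ 'n. \<Sum>i<d. \<Sum>j<e. (b i * c j) * (word_monomial i x * word_monomial j x))"
    by (intro monomial_combination_sum monomial_combination_scale) (rule W)
  moreover have "(\<lambda>x. p x * q x) =
      (\<lambda>x. \<Sum>i<d. \<Sum>j<e. (b i * c j) * (word_monomial i x * word_monomial j x))"
    unfolding p q by (auto simp: sum_product mult_ac)
  ultimately show ?case by simp
qed

section \<open>Homogeneous linear systems with more unknowns than equations\<close>

lemma homogeneous_system_solution:
  fixes v :: "'k \<Rightarrow> nat \<Rightarrow> 'a::field"
  assumes "finite K" "d < card K"
  shows "\<exists>c. (\<exists>k\<in>K. c k \<noteq> 0) \<and> (\<forall>i<d. (\<Sum>k\<in>K. c k * v k i) = 0)"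
  using assms
proof (induction d arbitrary: K v)
  case 0
  then have "K \<noteq> {}" by auto
  then show ?case by (intro exI[of _ "\<lambda>_. 1"]) auto
next
  case (Suc d)
  show ?case
  proof (cases "\<forall>k\<in>K. v k d = 0")
    case True
    obtain c where "\<exists>k\<in>K. c k \<noteq> 0" "\<forall>i<d. (\<Sum>k\<in>K. c k * v k i) = 0"
      using Suc.IH[of K v] Suc.prems by auto
    then show ?thesis using True by (intro exI[of _ c]) (auto simp: less_Suc_eq)
  next
    case False
    then obtain k0 where k0: "k0 \<in> K" "v k0 d \<noteq> 0" by blast
    let ?K = "K - {k0}"
    \<comment> \<open>Gaussian elimination: equation \<open>d\<close> is solved for the unknown of
      \<open>k0\<close>, and \<open>w\<close> holds the coefficients of the other equations after
      this substitution. The value of that unknown is the \<open>s\<close> below.\<close>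
    define w where "w = (\<lambda>k i. v k i - v k d / v k0 d * v k0 i)"
    have "finite ?K" "d < card ?K" using Suc.prems k0(1) by auto
    then obtain c where c: "\<exists>k\<in>?K. c k \<noteq> 0" "\<forall>i<d. (\<Sum>k\<in>?K. c k * w k i) = 0"
      using Suc.IH[of ?K w] by blast
    define s where "s = - (\<Sum>k\<in>?K. c k * v k d) / v k0 d"
    have "(\<Sum>k\<in>K. (c(k0 := s)) k * v k i) = 0" if "i < Suc d" for i
    proof -
      have "(\<Sum>k\<in>K. (c(k0 := s)) k * v k i) = s * v k0 i + (\<Sum>k\<in>?K. (c(k0 := s)) k * v k i)"
        using sum.remove[OF \<open>finite K\<close> k0(1), of "\<lambda>k. (c(k0 := s)) k * v k i"] by simp
      also have "(\<Sum>k\<in>?K. (c(k0 := s)) k * v k i) = (\<Sum>k\<in>?K. c k * v k i)"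
        by (rule sum.cong) auto
      also have "s * v k0 i = - (\<Sum>k\<in>?K. c k * (v k d / v k0 d * v k0 i))"
        by (simp add: s_def sum_distrib_right sum_divide_distrib flip: sum_negf) (simp add: mult_ac)
      also have "\<dots> + (\<Sum>k\<in>?K. c k * v k i) = (\<Sum>k\<in>?K. c k * w k i)"
        by (simp add: w_def right_diff_distrib sum_subtractf)
      also have "\<dots> = 0"
        using that c(2) k0(2) by (cases "i = d") (auto simp: w_def)
      finally show ?thesis .
    qed
    then show ?thesis using c(1) by (intro exI[of _ "c(k0 := s)"]) auto
  qed
qed

section \<open>Ideals of polynomial functions\<close>

definition polynomial_ideal :: "(complex ^ 'n::finite \<Rightarrow> complex) set \<Rightarrow> bool" where
  "polynomial_ideal I \<longleftrightarrow> I \<subseteq> Collect polynomial_fun \<and> (\<lambda>_. 0) \<in> I \<and>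
     (\<forall>p\<in>I. \<forall>q\<in>I. (\<lambda>x. p x + q x) \<in> I) \<and> (\<forall>p\<in>I. \<forall>q. polynomial_fun q \<longrightarrow> (\<lambda>x. q x * p x) \<in> I)"

lemma polynomial_idealD:
  assumes "polynomial_ideal I"
  shows "p \<in> I \<Longrightarrow> polynomial_fun p" "(\<lambda>_. 0) \<in> I"
    "p \<in> I \<Longrightarrow> q \<in> I \<Longrightarrow> (\<lambda>x. p x + q x) \<in> I"
    "p \<in> I \<Longrightarrow> polynomial_fun q \<Longrightarrow> (\<lambda>x. q x * p x) \<in> I"
  using assms unfolding polynomial_ideal_def by auto

lemma polynomial_ideal_sum:
  assumes "polynomial_ideal I" "\<And>k. k \<in> K \<Longrightarrow> p k \<in> I"
  shows "(\<lambda>x. \<Sum>k\<in>K. p k x) \<in> I"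
  using assms(2)
  by (induction K rule: infinite_finite_induct) (auto intro: polynomial_idealD[OF assms(1)])

lemma polynomial_ideal_adjoin:
  fixes I :: "(complex ^ 'n::finite \<Rightarrow> complex) set"
  assumes "polynomial_ideal I" "polynomial_fun a"
  defines "J \<equiv> {\<lambda>x. p x + g x * a x | p g. p \<in> I \<and> polynomial_fun g}"
  shows "polynomial_ideal J" "I \<subseteq> J" "a \<in> J"
proof -
  have JI: "(\<lambda>x. p x + g x * a x) \<in> J" if "p \<in> I" "polynomial_fun g" for p g
    using that unfolding J_def by blast
  note I = polynomial_idealD[OF assms(1)]
  show "I \<subseteq> J" using JI[OF _ polynomial_fun.const[of 0]] by auto
  show "a \<in> J" using JI[OF I(2) polynomial_fun.const[of 1]] by simp
  show "polynomial_ideal J" unfolding polynomial_ideal_def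
  proof (intro conjI ballI allI impI)
    show "J \<subseteq> Collect polynomial_fun" unfolding J_def
      by (auto intro!: polynomial_fun.add polynomial_fun.mult assms(2) dest: I(1))
    show "(\<lambda>_. 0) \<in> J" using \<open>I \<subseteq> J\<close> I(2) by blast
  next
    fix p q assume "p \<in> J" "q \<in> J"
    then obtain p' g q' h where p: "p = (\<lambda>x. p' x + g x * a x)" "p' \<in> I" "polynomial_fun g"
      and q: "q = (\<lambda>x. q' x + h x * a x)" "q' \<in> I" "polynomial_fun h" unfolding J_def by blast
    have "(\<lambda>x. (p' x + q' x) + (g x + h x) * a x) \<in> J"
      by (intro JI I(3) polynomial_fun.add p q)
    then show "(\<lambda>x. p x + q x) \<in> J" unfolding p(1) q(1) by (simp add: algebra_simps)
  next
    fix p and q :: "complex ^ 'n \<Rightarrow> complex" assume "p \<in> J" and r: "polynomial_fun q"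
    then obtain p' g where p: "p = (\<lambda>x. p' x + g x * a x)" "p' \<in> I" "polynomial_fun g"
      unfolding J_def by blast
    have "(\<lambda>x. q x * p' x + (q x * g x) * a x) \<in> J"
      by (intro JI I(4) polynomial_fun.mult p r)
    then show "(\<lambda>x. q x * p x) \<in> J" unfolding p(1) by (simp add: algebra_simps)
  qed
qed

text \<open>For \<open>h = 1\<close> these are the maximal ideals. Avoiding the powers of a general
  \<open>h\<close> plays the part of inverting \<open>h\<close>, so that no additional variable as
  in the Rabinowitsch trick is called for.\<close>

locale maximal_avoiding =
  fixes M :: "(complex ^ 'n::finite \<Rightarrow> complex) set" and h :: "complex ^ 'n \<Rightarrow> complex"
  assumes ideal: "polynomial_ideal M" and poly_h: "polynomial_fun h"
    and avoids: "(\<lambda>x. h x ^ n) \<notin> M"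
    and maximal: "polynomial_ideal J \<Longrightarrow> M \<subseteq> J \<Longrightarrow> (\<And>n. (\<lambda>x. h x ^ n) \<notin> J) \<Longrightarrow> J = M"
begin

text \<open>The ideal generated by \<open>M\<close> and \<open>a\<close> is strictly larger than
  \<open>M\<close>, so it contains a power of \<open>h\<close>: outside \<open>M\<close> everything
  is invertible modulo \<open>M\<close> up to powers of \<open>h\<close>.\<close>

lemma power_mod:
  assumes "polynomial_fun a" "a \<notin> M"
  obtains n g p where "polynomial_fun g" "p \<in> M" "\<And>x. h x ^ n = p x + g x * a x"
proof -
  let ?J = "{\<lambda>x. p x + g x * a x | p g. p \<in> M \<and> polynomial_fun g}"
  have "\<exists>n. (\<lambda>x. h x ^ n) \<in> ?J"
    using maximal[of ?J] polynomial_ideal_adjoin[OF ideal assms(1)] assms(2) by blast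
  then show thesis using that by (auto dest: fun_cong)
qed

text \<open>If neither factor were in \<open>M\<close>, some \<open>h ^ n\<close> and
  \<open>h ^ m\<close> would be multiples of \<open>a\<close> and \<open>b\<close> modulo
  \<open>M\<close>; multiplying them puts \<open>h ^ (n + m)\<close> into \<open>M\<close>.\<close>

lemma prime:
  assumes "polynomial_fun a" "polynomial_fun b" "(\<lambda>x. a x * b x) \<in> M"
  shows "a \<in> M \<or> b \<in> M"
proof (rule ccontr)
  assume *: "\<not> (a \<in> M \<or> b \<in> M)"
  obtain n g p where 1: "polynomial_fun g" "p \<in> M" "\<And>x. h x ^ n = p x + g x * a x"
    using power_mod[OF assms(1)] * by metis
  obtain m g' p' where 2: "polynomial_fun g'" "p' \<in> M" "\<And>x. h x ^ m = p' x + g' x * b x"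
    using power_mod[OF assms(2)] * by metis
  note I = polynomial_idealD[OF ideal]
  have "(\<lambda>x. h x ^ m * p x + (g x * a x) * p' x + (g x * g' x) * (a x * b x)) \<in> M"
    by (rule I(3)[OF I(3)[OF I(4)[OF 1(2)] I(4)[OF 2(2)]] I(4)[OF assms(3)]])
      (intro polynomial_fun.mult polynomial_fun_power poly_h 1 2 assms)+
  moreover have "h x ^ m * p x + (g x * a x) * p' x + (g x * g' x) * (a x * b x) = h x ^ (n + m)" for x
    by (simp only: power_add 1(3) 2(3)) (simp add: algebra_simps)
  ultimately show False using avoids by simp
qed

lemma const_notin: "c \<noteq> 0 \<Longrightarrow> (\<lambda>_. c) \<notin> M"
  using polynomial_idealD(4)[OF ideal _ polynomial_fun.const[of "1 / c"], of "\<lambda>_. c"] avoids[of 0]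
  by auto

text \<open>Over the complex numbers \<open>q\<close> splits into linear factors, and since
  \<open>M\<close> is prime, one of these factors evaluated at \<open>a\<close> lies in
  \<open>M\<close>.\<close>

lemma root_in:
  assumes "polynomial_fun a" "q \<noteq> 0" "(\<lambda>x. poly q (a x)) \<in> M"
  shows "\<exists>c. (\<lambda>x. a x - c) \<in> M"
  using assms(2,3)
proof (induction "degree q" arbitrary: q)
  case 0
  then obtain c where "q = [:c:]" "c \<noteq> 0" by (metis degree_eq_zeroE pCons_0_0)
  then show ?case using 0 const_notin by auto
next
  case (Suc d)
  then have "\<not> constant (poly q)" by (simp add: constant_degree)
  from Fundamental_Theorem_Algebra.fundamental_theorem_of_algebra[OF this] obtain c where "poly q c = 0" ..
  then have "[:- c, 1:] dvd q" by (simp add: poly_eq_0_iff_dvd)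
  then obtain r where r: "q = [:- c, 1:] * r" by (rule dvdE)
  have "r \<noteq> 0" using r Suc.prems by auto
  then have d: "d = degree r" using r Suc.hyps(2) by (simp add: degree_mult_eq del: mult_pCons_left)
  have "(\<lambda>x. (a x - c) * poly r (a x)) \<in> M"
    using Suc.prems(2) unfolding r poly_mult by (simp add: algebra_simps)
  then have "(\<lambda>x. a x - c) \<in> M \<or> (\<lambda>x. poly r (a x)) \<in> M"
    by (intro prime polynomial_fun_diff polynomial_fun_poly polynomial_fun.const assms(1))
  then show ?case using Suc.hyps(1)[OF d \<open>r \<noteq> 0\<close>] by blast
qed

text \<open>If no \<open>a - c\<close> were in \<open>M\<close>, then the uncountably many inverses of \<open>a - c\<close> modulo \<open>M\<close> and
  powers of \<open>h\<close> would have to be linearly independent in a space of countable dimension.\<close>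

lemma exists_value:
  assumes a: "polynomial_fun a"
  shows "\<exists>c. (\<lambda>x. a x - c) \<in> M"
proof (rule ccontr)
  assume no: "\<not> ?thesis"
  \<comment> \<open>\<open>power_mod\<close> makes each \<open>a - r\<close> invertible modulo
    \<open>M\<close> up to a power of \<open>h\<close>. Real values of \<open>r\<close> already form
    an uncountable family.\<close>
  have "\<exists>n g d. (\<lambda>x. h x ^ n - g x * (a x - of_real r)) \<in> M \<and> monomial_combination d g" for r :: real
  proof -
    obtain n g p where g: "polynomial_fun g" and p: "p \<in> M"
      and eq: "\<And>x. h x ^ n = p x + g x * (a x - of_real r)"
      using power_mod[OF polynomial_fun_diff[OF a polynomial_fun.const[of "of_real r"]]] no by metis
    have "(\<lambda>x. h x ^ n - g x * (a x - of_real r)) = p" using eq by auto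
    then have mem: "(\<lambda>x. h x ^ n - g x * (a x - of_real r)) \<in> M" using p by simp
    obtain d where d: "monomial_combination d g" using polynomial_fun_monomial_combination[OF g] ..
    show ?thesis by (intro exI conjI) (rule mem, rule d)
  qed
  then have "\<forall>r :: real. \<exists>t. (\<lambda>x. h x ^ fst t - fst (snd t) x * (a x - of_real r)) \<in> M \<and>
      monomial_combination (snd (snd t)) (fst (snd t))" by simp
  from choice[OF this] obtain t where t: "\<And>r :: real.
      (\<lambda>x. h x ^ fst (t r) - fst (snd (t r)) x * (a x - of_real r)) \<in> M \<and>
      monomial_combination (snd (snd (t r))) (fst (snd (t r)))" by blast
  define n g d where "n r = fst (t r)" and "g r = fst (snd (t r))" and "d r = snd (snd (t r))" for r
  have g: "(\<lambda>x. h x ^ n r - g r x * (a x - of_real r)) \<in> M" "monomial_combination (d r) (g r)"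
    for r using t[of r] by (auto simp: n_def g_def d_def)
  \<comment> \<open>Every real \<open>r\<close> carries one of countably many labels
    \<open>(n r, d r)\<close>, so some label occurs infinitely often.\<close>
  have "\<exists>N e. infinite {r. n r = N \<and> d r = e}"
  proof (rule ccontr)
    assume "\<not> ?thesis"
    then have "countable (\<Union>(N, e)\<in>UNIV. {r. n r = N \<and> d r = e})"
      by (intro countable_UN) (auto intro: countable_finite)
    moreover have "(\<Union>(N, e)\<in>UNIV. {r. n r = N \<and> d r = e}) = UNIV" by auto
    ultimately show False using uncountable_UNIV_real by simp
  qed
  then obtain N e where "infinite {r. n r = N \<and> d r = e}" by blast
  then obtain K where K: "finite K" "card K = Suc e" "K \<subseteq> {r. n r = N \<and> d r = e}"
    using infinite_arbitrarily_large by blast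
  have "\<forall>r\<in>K. \<exists>v. g r = (\<lambda>x. \<Sum>i<e. v i * word_monomial i x)"
    using K(3) g(2) unfolding monomial_combination_def by blast
  then obtain v where v: "\<And>r. r \<in> K \<Longrightarrow> g r = (\<lambda>x. \<Sum>i<e. v r i * word_monomial i x)" by metis
  \<comment> \<open>The \<open>Suc e\<close> polynomials \<open>g k\<close> lie in the span of
    \<open>e\<close> monomials, which forces a linear relation.\<close>
  obtain c where c: "\<exists>k\<in>K. c k \<noteq> 0" "\<forall>i<e. (\<Sum>k\<in>K. c k * v k i) = 0"
    using homogeneous_system_solution[of K e v] K by auto
  have rel: "(\<Sum>k\<in>K. c k * g k x) = 0" for x
  proof -
    have "(\<Sum>k\<in>K. c k * g k x) = (\<Sum>k\<in>K. \<Sum>i<e. c k * v k i * word_monomial i x)"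
      by (rule sum.cong) (auto simp: v sum_distrib_left mult.assoc)
    also have "\<dots> = (\<Sum>i<e. (\<Sum>k\<in>K. c k * v k i) * word_monomial i x)"
      by (subst sum.swap) (simp add: sum_distrib_right)
    finally show ?thesis using c(2) by simp
  qed
  \<comment> \<open>The numerator of the sum of all \<open>c k / (y - k)\<close> over the common
    denominator. At \<open>k0\<close> only the summand of \<open>k0\<close> survives, hence
    \<open>q\<close> is nonzero.\<close>
  define q :: "complex poly"
    where "q = (\<Sum>k\<in>K. smult (c k) (\<Prod>l\<in>K - {k}. [:- of_real l, 1:]))"
  have poly_q: "poly q y = (\<Sum>k\<in>K. c k * (\<Prod>l\<in>K - {k}. y - of_real l))" for y
    by (simp add: q_def poly_sum poly_prod)
  obtain k0 where k0: "k0 \<in> K" "c k0 \<noteq> 0" using c(1) by blast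
  have "poly q (of_real k0) = (\<Sum>k\<in>{k0}. c k * (\<Prod>l\<in>K - {k}. of_real k0 - of_real l))"
    unfolding poly_q
    by (rule sum.mono_neutral_right) (use K(1) k0(1) in \<open>auto simp: prod_zero_iff\<close>)
  also have "\<dots> \<noteq> 0" using k0 K(1) by (auto simp: prod_zero_iff)
  finally have "q \<noteq> 0" by auto
  \<comment> \<open>Modulo \<open>M\<close> each \<open>g k * (a - k)\<close> equals
    \<open>h ^ N\<close>. Clearing denominators in the relation between the \<open>g k\<close>
    therefore puts \<open>h ^ N * q(a)\<close> into \<open>M\<close>.\<close>
  have "(\<lambda>x. \<Sum>k\<in>K. (c k * (\<Prod>l\<in>K - {k}. a x - of_real l)) * (h x ^ N - g k x * (a x - of_real k))) \<in> M"
  proof (rule polynomial_ideal_sum[OF ideal], rule polynomial_idealD(4)[OF ideal])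
    fix k assume "k \<in> K"
    then have "n k = N" using K(3) by blast
    then show "(\<lambda>x. h x ^ N - g k x * (a x - of_real k)) \<in> M" using g(1)[of k] by simp
    show "polynomial_fun (\<lambda>x. c k * (\<Prod>l\<in>K - {k}. a x - of_real l))"
      by (intro polynomial_fun.mult polynomial_fun.const polynomial_fun_prod polynomial_fun_diff a)
  qed
  moreover have "(\<Sum>k\<in>K. (c k * (\<Prod>l\<in>K - {k}. a x - of_real l)) * (h x ^ N - g k x * (a x - of_real k)))
      = h x ^ N * poly q (a x)" for x
  proof -
    have "(c k * (\<Prod>l\<in>K - {k}. a x - of_real l)) * (g k x * (a x - of_real k)) =
        (\<Prod>l\<in>K. a x - of_real l) * (c k * g k x)" if "k \<in> K" for k
      using prod.remove[OF K(1) that, of "\<lambda>l. a x - of_real l"] by (simp only: mult_ac)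
    then have "(\<Sum>k\<in>K. (c k * (\<Prod>l\<in>K - {k}. a x - of_real l)) * (g k x * (a x - of_real k)))
        = (\<Sum>k\<in>K. (\<Prod>l\<in>K. a x - of_real l) * (c k * g k x))"
      by (intro sum.cong refl)
    also have "\<dots> = 0" using rel[of x] by (simp flip: sum_distrib_left)
    finally have z: "(\<Sum>k\<in>K. (c k * (\<Prod>l\<in>K - {k}. a x - of_real l)) * (g k x * (a x - of_real k))) = 0" .
    show ?thesis
      unfolding right_diff_distrib[of "c _ * prod _ _"] sum_subtractf z poly_q
      by (simp add: sum_distrib_left mult.commute)
  qed
  ultimately have "(\<lambda>x. h x ^ N * poly q (a x)) \<in> M" by simp
  then have "(\<lambda>x. poly q (a x)) \<in> M"
    using prime[OF polynomial_fun_power[OF poly_h] polynomial_fun_poly[OF a]] avoids by blast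
  then show False using root_in[OF a \<open>q \<noteq> 0\<close>] no by blast
qed

text \<open>Each coordinate is congruent modulo \<open>M\<close> to a constant. These constants form
  a point \<open>z\<close>, and every polynomial is congruent to its value at \<open>z\<close>, so
  elements of \<open>M\<close> vanish there while \<open>h\<close> does not.\<close>

lemma exists_zero: "\<exists>z. h z \<noteq> 0 \<and> (\<forall>p\<in>M. p z = 0)"
proof -
  have "\<forall>j. \<exists>c. (\<lambda>x. x $ j - c) \<in> M" by (intro allI exists_value polynomial_fun.coord)
  then obtain c where c: "\<And>j. (\<lambda>x. x $ j - c j) \<in> M" by metis
  define z where "z = (\<chi> j. c j)"
  note I = polynomial_idealD[OF ideal]
  have eval: "(\<lambda>x. p x - p z) \<in> M" if "polynomial_fun p" for p
    using that
  proof induction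
    case (const c)
    then show ?case using I(2) by simp
  next
    case (coord i)
    then show ?case using c by (simp add: z_def)
  next
    case (add p q)
    then show ?case using I(3)[OF add.IH] by (simp add: algebra_simps)
  next
    case (mult p q)
    have "(\<lambda>x. q x * (p x - p z) + p z * (q x - q z)) \<in> M"
      by (intro I(3,4) mult polynomial_fun.const)
    then show ?case by (simp add: algebra_simps)
  qed
  have "p z = 0" if "p \<in> M" for p
  proof (rule ccontr)
    assume nz: "p z \<noteq> 0"
    have "(\<lambda>x. p x + (-1) * (p x - p z)) \<in> M"
      by (intro I(3,4) that eval I(1)[OF that] polynomial_fun.const)
    then show False using const_notin[OF nz] by simp
  qed
  moreover have "h z \<noteq> 0" using eval[OF poly_h] avoids[of 1] by auto
  ultimately show ?thesis by blast
qed

end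

text \<open>If no power of \<open>h\<close> were in \<open>I\<close>, Zorn's lemma would enlarge
  \<open>I\<close> to an ideal maximal among those avoiding these powers; its zero from
  \<open>exists_zero\<close> contradicts \<open>van\<close>.\<close>

theorem nullstellensatz:
  fixes I :: "(complex ^ 'a::finite \<Rightarrow> complex) set"
  assumes I: "polynomial_ideal I" and h: "polynomial_fun h"
    and van: "\<And>z. (\<And>p. p \<in> I \<Longrightarrow> p z = 0) \<Longrightarrow> h z = 0"
  shows "\<exists>n. (\<lambda>x. h x ^ n) \<in> I"
proof (rule ccontr)
  assume no: "\<not> ?thesis"
  let ?A = "{J. polynomial_ideal J \<and> I \<subseteq> J \<and> (\<forall>n. (\<lambda>x. h x ^ n) \<notin> J)}"
  have "\<exists>M\<in>?A. \<forall>J\<in>?A. M \<subseteq> J \<longrightarrow> J = M"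
  proof (rule subset_Zorn_nonempty)
    show "?A \<noteq> {}" using I no by blast
    fix C assume C: "C \<noteq> {}" "subset.chain ?A C"
    then have sub: "C \<subseteq> ?A" and tot: "J \<in> C \<Longrightarrow> K \<in> C \<Longrightarrow> J \<subseteq> K \<or> K \<subseteq> J" for J K
      unfolding subset.chain_def by blast+
    have idl: "polynomial_ideal J" and IJ: "I \<subseteq> J" and av: "(\<lambda>x. h x ^ n) \<notin> J"
      if "J \<in> C" for J n using subsetD[OF sub that] by blast+
    obtain J0 where J0: "J0 \<in> C" using C(1) by blast
    have "polynomial_ideal (\<Union>C)" unfolding polynomial_ideal_def
    proof (intro conjI ballI allI impI)
      show "\<Union>C \<subseteq> Collect polynomial_fun" using polynomial_idealD(1)[OF idl] by blast
      show "(\<lambda>_. 0) \<in> \<Union>C" using J0 polynomial_idealD(2)[OF idl[OF J0]] by blast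
    next
      fix p q assume "p \<in> \<Union>C" "q \<in> \<Union>C"
      then obtain J K where J: "p \<in> J" "J \<in> C" and K: "q \<in> K" "K \<in> C" by blast
      have "\<exists>L\<in>C. p \<in> L \<and> q \<in> L" using tot[OF J(2) K(2)] J K by (elim disjE) blast+
      then obtain L where L: "L \<in> C" "p \<in> L" "q \<in> L" by blast
      show "(\<lambda>x. p x + q x) \<in> \<Union>C"
        by (rule UnionI[OF L(1) polynomial_idealD(3)[OF idl[OF L(1)] L(2,3)]])
    next
      fix p and q :: "complex ^ 'a \<Rightarrow> complex" assume "p \<in> \<Union>C" and q: "polynomial_fun q"
      then obtain J where J: "p \<in> J" "J \<in> C" by blast
      show "(\<lambda>x. q x * p x) \<in> \<Union>C"
        by (rule UnionI[OF J(2) polynomial_idealD(4)[OF idl[OF J(2)] J(1) q]])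
    qed
    moreover have "I \<subseteq> \<Union>C" using IJ[OF J0] J0 by blast
    moreover have "(\<lambda>x. h x ^ n) \<notin> \<Union>C" for n using av by (meson UnionE)
    ultimately show "\<Union>C \<in> ?A" by simp
  qed
  then obtain M where M: "M \<in> ?A" and mx: "\<forall>J\<in>?A. M \<subseteq> J \<longrightarrow> J = M" by (elim bexE)
  interpret maximal_avoiding M h
  proof unfold_locales
    show "J = M" if "polynomial_ideal J" "M \<subseteq> J" "\<And>n. (\<lambda>x. h x ^ n) \<notin> J" for J
    proof -
      have "J \<in> ?A" using that M by auto
      then show ?thesis using mx that(2) by simp
    qed
  qed (use M h in auto)
  obtain z :: "complex ^ 'a" where z: "h z \<noteq> 0" "\<And>p. p \<in> M \<Longrightarrow> p z = 0" using exists_zero by blast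
  have "h z = 0" using M by (intro van z(2)) auto
  then show False using z(1) by simp
qed


section \<open>Regular functions as polynomials\<close>

text \<open>Zariski closedness in the form in which it is used: one polynomial separates a point
  outside from the set.\<close>

definition algebraic_set :: "(complex ^ 'n::finite) set \<Rightarrow> bool" where
  "algebraic_set V \<longleftrightarrow> (\<forall>x. x \<notin> V \<longrightarrow> (\<exists>p. polynomial_fun p \<and> p x \<noteq> 0 \<and> (\<forall>y\<in>V. p y = 0)))"

lemma openin_zariski_nonvanishing: "polynomial_fun p \<Longrightarrow> openin zariski {x. p x \<noteq> 0}"
  unfolding zariski_def openin_topology_generated_by_iff by (blast intro: generate_topology_on.Basis)

lemma openin_zariski_UNIV: "openin zariski UNIV"
  using openin_zariski_nonvanishing[OF polynomial_fun.const[of 1]] by simp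

text \<open>The nonvanishing sets form a base and not merely a subbase, since the product of two
  polynomials describes an intersection.\<close>

lemma openin_zariski_basic:
  assumes "openin zariski U" "x \<in> U"
  shows "\<exists>p. polynomial_fun p \<and> p x \<noteq> 0 \<and> (\<forall>y. p y \<noteq> 0 \<longrightarrow> y \<in> U)"
proof -
  have "generate_topology_on {{x. p x \<noteq> 0} | p. polynomial_fun p} U"
    using assms(1) unfolding zariski_def openin_topology_generated_by_iff .
  then show ?thesis using assms(2)
  proof (induction arbitrary: x rule: generate_topology_on.induct)
    case (Int a b)
    obtain p q where p: "polynomial_fun p" "p x \<noteq> 0" "\<forall>y. p y \<noteq> 0 \<longrightarrow> y \<in> a"
      and q: "polynomial_fun q" "q x \<noteq> 0" "\<forall>y. q y \<noteq> 0 \<longrightarrow> y \<in> b"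
      using Int.IH(1)[of x] Int.IH(2)[of x] Int.prems by blast
    then show ?case by (intro exI[of _ "\<lambda>x. p x * q x"]) (auto intro: polynomial_fun.mult)
  next
    case (UN K)
    then obtain k where k: "k \<in> K" "x \<in> k" by blast
    show ?case using UN.IH[OF k] k(1) by blast
  qed auto
qed

lemma algebraic_set_closedin:
  fixes V :: "(complex ^ 'n::finite) set"
  assumes "closedin zariski V"
  shows "algebraic_set V"
proof -
  have "topspace zariski = (UNIV :: (complex ^ 'n) set)" using openin_zariski_UNIV openin_subset by blast
  then have "openin zariski (- V)" using assms by (auto simp: closedin_def Compl_eq_Diff_UNIV)
  then show ?thesis unfolding algebraic_set_def using openin_zariski_basic[of "- V"] by blast
qed

text \<open>The denominators of \<open>f\<close> form an ideal whose zeros lie in \<open>h = 0\<close>.\<close>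

lemma regular_on_fraction:
  fixes V :: "(complex ^ 'n::finite) set"
  assumes V: "algebraic_set V" and h: "polynomial_fun h" and f: "regular_on {x\<in>V. h x \<noteq> 0} f"
  shows "\<exists>n P. polynomial_fun P \<and> (\<forall>x\<in>V. h x \<noteq> 0 \<longrightarrow> h x ^ n * f x = P x)"
proof -
  define I where "I = {r. polynomial_fun r \<and>
    (\<exists>s. polynomial_fun s \<and> (\<forall>x\<in>V. h x \<noteq> 0 \<longrightarrow> r x * f x = s x))}"
  have II: "r \<in> I" if "polynomial_fun r" "polynomial_fun s" "\<And>x. x \<in> V \<Longrightarrow> h x \<noteq> 0 \<Longrightarrow> r x * f x = s x" for r s
    using that unfolding I_def by blast
  have "polynomial_ideal I" unfolding polynomial_ideal_def
  proof (intro conjI ballI allI impI)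
    show "I \<subseteq> Collect polynomial_fun" unfolding I_def by blast
    show "(\<lambda>_. 0) \<in> I" by (rule II[OF polynomial_fun.const polynomial_fun.const[of 0]]) simp
  next
    fix p q assume "p \<in> I" "q \<in> I"
    then obtain s t where s: "polynomial_fun p" "polynomial_fun s" "\<And>x. x \<in> V \<Longrightarrow> h x \<noteq> 0 \<Longrightarrow> p x * f x = s x"
      and t: "polynomial_fun q" "polynomial_fun t" "\<And>x. x \<in> V \<Longrightarrow> h x \<noteq> 0 \<Longrightarrow> q x * f x = t x"
      unfolding I_def by blast
    show "(\<lambda>x. p x + q x) \<in> I"
      by (rule II[OF polynomial_fun.add[OF s(1) t(1)] polynomial_fun.add[OF s(2) t(2)]])
        (simp add: s(3) t(3) distrib_right)
  next
    fix p and q :: "complex ^ 'n \<Rightarrow> complex" assume "p \<in> I" and q: "polynomial_fun q"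
    then obtain s where s: "polynomial_fun p" "polynomial_fun s" "\<And>x. x \<in> V \<Longrightarrow> h x \<noteq> 0 \<Longrightarrow> p x * f x = s x"
      unfolding I_def by blast
    show "(\<lambda>x. q x * p x) \<in> I"
      by (rule II[OF polynomial_fun.mult[OF q s(1)] polynomial_fun.mult[OF q s(2)]])
        (simp add: s(3) mult.assoc)
  qed
  moreover have "h z = 0" if z: "\<And>p. p \<in> I \<Longrightarrow> p z = 0" for z
  proof (rule ccontr)
    assume hz: "h z \<noteq> 0"
    \<comment> \<open>Polynomials vanishing on \<open>V\<close> belong to \<open>I\<close> with
      numerator 0, so the zeros of \<open>I\<close> lie in \<open>V\<close>.\<close>
    have "z \<in> V"
    proof (rule ccontr)
      assume "z \<notin> V"
      then obtain p where p: "polynomial_fun p" "p z \<noteq> 0" "\<forall>y\<in>V. p y = 0"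
        using V unfolding algebraic_set_def by blast
      have "p \<in> I" by (rule II[OF p(1) polynomial_fun.const[of 0]]) (simp add: p(3))
      then show False using z p(2) by blast
    qed
    then obtain U p q where U: "openin zariski U" "z \<in> U" "polynomial_fun p" "polynomial_fun q"
        "\<forall>y\<in>{x\<in>V. h x \<noteq> 0} \<inter> U. q y \<noteq> 0 \<and> f y = p y / q y"
      using f hz unfolding regular_on_def by blast
    \<comment> \<open>The factor \<open>g\<close> vanishes off \<open>U\<close>, which extends the
      local identity \<open>q f = p\<close> to \<open>g q f = g p\<close> on all of \<open>V\<close>
      where \<open>h\<close> is nonzero.\<close>
    obtain g where g: "polynomial_fun g" "g z \<noteq> 0" "\<forall>y. g y \<noteq> 0 \<longrightarrow> y \<in> U"
      using openin_zariski_basic[OF U(1,2)] by blast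
    have "(\<lambda>x. g x * q x) \<in> I"
    proof (rule II[OF polynomial_fun.mult[OF g(1) U(4)] polynomial_fun.mult[OF g(1) U(3)]])
      fix x assume "x \<in> V" "h x \<noteq> 0"
      then show "g x * q x * f x = g x * p x" using U(5) g(3) by (cases "g x = 0") auto
    qed
    then show False using z[of "\<lambda>x. g x * q x"] g(2) U(2,5) \<open>z \<in> V\<close> hz by auto
  qed
  ultimately obtain n where "(\<lambda>x. h x ^ n) \<in> I" using nullstellensatz[OF _ h] by blast
  then show ?thesis unfolding I_def by blast
qed

text \<open>The case \<open>h = 1\<close>: on a closed set the local fractions come from one
  polynomial.\<close>

lemma regular_on_polynomial:
  assumes "algebraic_set V" "regular_on V f"
  shows "\<exists>P. polynomial_fun P \<and> (\<forall>x\<in>V. f x = P x)"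
  using regular_on_fraction[of V "\<lambda>_. 1" f] assms polynomial_fun.const[of 1] by auto

lemma polynomial_regular_on:
  assumes "polynomial_fun P" "\<And>x. x \<in> S \<Longrightarrow> f x = P x"
  shows "regular_on S f"
  unfolding regular_on_def
proof
  fix x
  show "\<exists>U p q. openin zariski U \<and> x \<in> U \<and> polynomial_fun p \<and> polynomial_fun q \<and>
      (\<forall>y\<in>S \<inter> U. q y \<noteq> 0 \<and> f y = p y / q y)"
    by (rule exI[of _ UNIV], rule exI[of _ P], rule exI[of _ "\<lambda>_. 1"])
      (simp add: assms polynomial_fun.const openin_zariski_UNIV)
qed

text \<open>Matches the convention of \<open>regular_funs\<close> that regular functions are 0 off
  \<open>X\<close>.\<close>

definition restr :: "(complex ^ 'n) set \<Rightarrow> (complex ^ 'n \<Rightarrow> complex) \<Rightarrow> complex ^ 'n \<Rightarrow> complex" where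
  "restr X P = (\<lambda>x. if x \<in> X then P x else 0)"

lemma restr_regular: "polynomial_fun P \<Longrightarrow> restr X P \<in> regular_funs X"
  unfolding regular_funs_def restr_def by (auto intro: polynomial_regular_on[of P])

lemma regular_funsE:
  assumes "algebraic_set X" "f \<in> regular_funs X"
  obtains P where "polynomial_fun P" "f = restr X P"
proof -
  obtain P where "polynomial_fun P" "\<forall>x\<in>X. f x = P x"
    using regular_on_polynomial[OF assms(1)] assms(2) unfolding regular_funs_def by blast
  moreover from this have "f = restr X P"
    using assms(2) unfolding regular_funs_def restr_def by auto
  ultimately show thesis using that by blast
qed

lemma regular_funs_outside: "f \<in> regular_funs X \<Longrightarrow> x \<notin> X \<Longrightarrow> f x = 0"
  unfolding regular_funs_def by blast

lemma regular_funsI: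
  assumes "polynomial_fun P" "\<And>x. x \<in> X \<Longrightarrow> f x = P x" "\<And>x. x \<notin> X \<Longrightarrow> f x = 0"
  shows "f \<in> regular_funs X"
  unfolding regular_funs_def using polynomial_regular_on[OF assms(1)] assms(2,3) by blast

section \<open>The ring of regular functions on a closed set\<close>

context
  fixes X :: "(complex ^ 'n::finite) set"
  assumes X: "algebraic_set X"
begin

lemma regular_funs_add:
  assumes "f \<in> regular_funs X" "g \<in> regular_funs X"
  shows "(\<lambda>x. f x + g x) \<in> regular_funs X"
proof -
  obtain P Q where "polynomial_fun P" "f = restr X P" "polynomial_fun Q" "g = restr X Q"
    using assms regular_funsE[OF X] by metis
  then show ?thesis
    by (intro regular_funsI[of "\<lambda>x. P x + Q x"] polynomial_fun.add) (auto simp: restr_def)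
qed

lemma regular_funs_mult:
  assumes "f \<in> regular_funs X" "g \<in> regular_funs X"
  shows "(\<lambda>x. f x * g x) \<in> regular_funs X"
proof -
  obtain P Q where "polynomial_fun P" "f = restr X P" "polynomial_fun Q" "g = restr X Q"
    using assms regular_funsE[OF X] by metis
  then show ?thesis
    by (intro regular_funsI[of "\<lambda>x. P x * Q x"] polynomial_fun.mult) (auto simp: restr_def)
qed

lemma regular_funs_scale:
  assumes "f \<in> regular_funs X"
  shows "(\<lambda>x. c * f x) \<in> regular_funs X"
proof -
  obtain P where "polynomial_fun P" "f = restr X P"
    using assms regular_funsE[OF X] by metis
  then show ?thesis
    by (intro regular_funsI[of "\<lambda>x. c * P x"] polynomial_fun.mult polynomial_fun.const)
      (auto simp: restr_def)
qed

lemma regular_funs_const: "restr X (\<lambda>_. c) \<in> regular_funs X"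
  by (intro restr_regular polynomial_fun.const)

lemma regular_funs_power: "f \<in> regular_funs X \<Longrightarrow> restr X (\<lambda>x. f x ^ n) \<in> regular_funs X"
proof -
  assume "f \<in> regular_funs X"
  then obtain P where "polynomial_fun P" "f = restr X P" using regular_funsE[OF X] by metis
  then show ?thesis
    by (intro regular_funsI[of "\<lambda>x. P x ^ n"] polynomial_fun_power) (auto simp: restr_def)
qed

text \<open>Supplies the ideal \<open>J\<close> of the final theorem, which is the unit
  ideal.\<close>

lemma ideal_regular_funs: "ideal (regular_funs X) (coord_ring X)"
proof -
  have "abelian_group (coord_ring X)"
  proof (rule abelian_groupI)
    fix f assume "f \<in> carrier (coord_ring X)"
    then have "(\<lambda>x. (-1) * f x) \<in> carrier (coord_ring X)"
      using regular_funs_scale[of f "-1"] by (simp only: coord_ring_def) simp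
    then show "\<exists>g\<in>carrier (coord_ring X). g \<oplus>\<^bsub>coord_ring X\<^esub> f = \<zero>\<^bsub>coord_ring X\<^esub>"
      by (rule bexI[rotated]) (simp add: coord_ring_def)
  qed (use regular_funs_add regular_funs_const[of 0] in
    \<open>auto simp: coord_ring_def restr_def algebra_simps\<close>)
  moreover have "monoid (coord_ring X)"
    by (rule monoidI) (use regular_funs_mult regular_funs_const[of 1] regular_funs_outside in
      \<open>auto simp: coord_ring_def restr_def fun_eq_iff algebra_simps\<close>)
  ultimately have "ring (coord_ring X)"
    by (rule ringI) (auto simp: coord_ring_def algebra_simps)
  from ring.oneideal[OF this] show ?thesis by (simp add: coord_ring_def)
qed

end


section \<open>Products and algebraic actions\<close>

lemma join_nth [simp]: "join x y $ Inl a = x $ a" "join x y $ Inr b = y $ b"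
  by (simp_all add: join_def)

lemma proj_join [simp]: "proj1 (join x y) = x" "proj2 (join x y) = y"
  by (simp_all add: proj1_def proj2_def vec_eq_iff)

lemma join_proj: "join (proj1 z) (proj2 z) = z"
  by (auto simp: vec_eq_iff join_def proj1_def proj2_def split: sum.split)

lemma mem_direct_product: "z \<in> direct_product S T \<longleftrightarrow> proj1 z \<in> S \<and> proj2 z \<in> T"
  unfolding direct_product_def by (auto intro: join_proj[symmetric])

lemma join_in_direct_product [simp]: "join x y \<in> direct_product S T \<longleftrightarrow> x \<in> S \<and> y \<in> T"
  by (simp add: mem_direct_product)

lemma polynomial_fun_proj1: "polynomial_fun p \<Longrightarrow> polynomial_fun (\<lambda>z. p (proj1 z))"
  by (rule polynomial_fun_comp) (auto simp: proj1_def intro: polynomial_fun.coord)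

lemma polynomial_fun_proj2: "polynomial_fun p \<Longrightarrow> polynomial_fun (\<lambda>z. p (proj2 z))"
  by (rule polynomial_fun_comp) (auto simp: proj2_def intro: polynomial_fun.coord)

lemma algebraic_set_direct_product:
  assumes "algebraic_set S" "algebraic_set T"
  shows "algebraic_set (direct_product S T)"
  unfolding algebraic_set_def
proof (intro allI impI)
  fix z assume "z \<notin> direct_product S T"
  then consider "proj1 z \<notin> S" | "proj2 z \<notin> T" by (auto simp: mem_direct_product)
  then show "\<exists>p. polynomial_fun p \<and> p z \<noteq> 0 \<and> (\<forall>y\<in>direct_product S T. p y = 0)"
  proof cases
    case 1
    then obtain p where "polynomial_fun p" "p (proj1 z) \<noteq> 0" "\<forall>y\<in>S. p y = 0"
      using assms(1) unfolding algebraic_set_def by blast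
    then show ?thesis
      by (intro exI[of _ "\<lambda>z. p (proj1 z)"]) (auto simp: mem_direct_product polynomial_fun_proj1)
  next
    case 2
    then obtain p where "polynomial_fun p" "p (proj2 z) \<noteq> 0" "\<forall>y\<in>T. p y = 0"
      using assms(2) unfolding algebraic_set_def by blast
    then show ?thesis
      by (intro exI[of _ "\<lambda>z. p (proj2 z)"]) (auto simp: mem_direct_product polynomial_fun_proj2)
  qed
qed

lemma algebraic_set_UNIV: "algebraic_set UNIV"
  by (simp add: algebraic_set_def)

lemma vec_1_eq: "(v :: complex ^ 1) = vec (v $ 1)"
  by (auto simp: vec_eq_iff)

text \<open>The first coordinate is the time, and powers of it are collected. The degree bound does
  not depend on the point, which gives later sums a fixed range.\<close>

lemma polynomial_fun_expand:
  fixes P :: "complex ^ (1 + 'n::finite) \<Rightarrow> complex"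
  assumes "polynomial_fun P"
  shows "\<exists>Q d. (\<forall>m. polynomial_fun (\<lambda>x. coeff (Q x) m)) \<and> (\<forall>x. degree (Q x) \<le> d) \<and>
    (\<forall>s x. P (join (vec s) x) = poly (Q x) s)"
  using assms
proof induction
  case (const c)
  have "polynomial_fun (\<lambda>x. coeff [:c:] m)" for m by (rule polynomial_fun.const)
  then show ?case by (intro exI[of _ "\<lambda>_. [:c:]"] exI[of _ 0]) auto
next
  case (coord i)
  show ?case
  proof (cases i)
    case (Inl a)
    have "polynomial_fun (\<lambda>x. coeff [:0, 1:] m)" for m by (rule polynomial_fun.const)
    then show ?thesis using Inl by (intro exI[of _ "\<lambda>_. [:0, 1:]"] exI[of _ 1]) auto
  next
    case (Inr b)
    have "polynomial_fun (\<lambda>x. coeff [:x $ b:] m)" for m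
      by (cases m) (auto intro: polynomial_fun.coord polynomial_fun.const)
    then show ?thesis using Inr by (intro exI[of _ "\<lambda>x. [:x $ b:]"] exI[of _ 0]) auto
  qed
next
  case (add p q)
  then obtain Q d R e where Q: "\<forall>m. polynomial_fun (\<lambda>x. coeff (Q x) m)" "\<forall>x. degree (Q x) \<le> d"
      "\<forall>s x. p (join (vec s) x) = poly (Q x) s"
    and R: "\<forall>m. polynomial_fun (\<lambda>x. coeff (R x) m)" "\<forall>x. degree (R x) \<le> e"
      "\<forall>s x. q (join (vec s) x) = poly (R x) s" by auto
  show ?case
    by (intro exI[of _ "\<lambda>x. Q x + R x"] exI[of _ "max d e"])
      (use Q R in \<open>auto intro!: polynomial_fun.add degree_add_le intro: max.coboundedI1 max.coboundedI2\<close>)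
next
  case (mult p q)
  then obtain Q d R e where Q: "\<forall>m. polynomial_fun (\<lambda>x. coeff (Q x) m)" "\<forall>x. degree (Q x) \<le> d"
      "\<forall>s x. p (join (vec s) x) = poly (Q x) s"
    and R: "\<forall>m. polynomial_fun (\<lambda>x. coeff (R x) m)" "\<forall>x. degree (R x) \<le> e"
      "\<forall>s x. q (join (vec s) x) = poly (R x) s" by auto
  have "degree (Q x * R x) \<le> d + e" for x
    using degree_mult_le[of "Q x" "R x"] Q(2) R(2) by (meson add_mono order_trans)
  moreover have "polynomial_fun (\<lambda>x. coeff (Q x * R x) m)" for m
    unfolding coeff_mult using Q(1) R(1) by (intro polynomial_fun_sum polynomial_fun.mult) auto
  ultimately show ?case
    by (intro exI[of _ "\<lambda>x. Q x * R x"] exI[of _ "d + e"]) (use Q R in auto)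
qed

lemma algebraic_action_polynomial:
  fixes S :: "(complex ^ 'n::finite) set"
  assumes S: "algebraic_set S" and \<Phi>: "algebraic_action S \<Phi>"
  shows "\<exists>P :: 'n \<Rightarrow> complex ^ (1 + 'n) \<Rightarrow> complex. (\<forall>j. polynomial_fun (P j)) \<and>
    (\<forall>t. \<forall>x\<in>S. \<forall>j. \<Phi> t x $ j = P j (join (vec t) x))"
proof -
  have "\<exists>P. polynomial_fun P \<and> (\<forall>z\<in>direct_product affine_line S. action_map \<Phi> z $ j = P z)" for j
    using \<Phi> by (intro regular_on_polynomial algebraic_set_direct_product algebraic_set_UNIV S)
      (auto simp: algebraic_action_def regular_map_def)
  then obtain P where P: "\<And>j. polynomial_fun (P j)"
      "\<And>j z. z \<in> direct_product affine_line S \<Longrightarrow> action_map \<Phi> z $ j = P j z" by metis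
  have "\<Phi> t x $ j = P j (join (vec t) x)" if "x \<in> S" for t x j
    using P(2)[of "join (vec t) x" j] that by (simp add: action_map_def)
  then show ?thesis using P(1) by blast
qed

lemma algebraic_actionI:
  fixes P :: "'n::finite \<Rightarrow> complex ^ (1 + 'n) \<Rightarrow> complex"
  assumes "additive_action S \<Phi>" and P: "\<And>j. polynomial_fun (P j)"
    and eq: "\<And>t x j. x \<in> S \<Longrightarrow> \<Phi> t x $ j = P j (join (vec t) x)"
  shows "algebraic_action S \<Phi>"
  unfolding algebraic_action_def regular_map_def
proof (intro conjI allI)
  show "action_map \<Phi> ` direct_product affine_line S \<subseteq> S"
    using assms(1) by (auto simp: additive_action_def mem_direct_product action_map_def)
  show "regular_on (direct_product affine_line S) (\<lambda>x. action_map \<Phi> x $ j)" for j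
  proof (rule polynomial_regular_on[OF P])
    fix z assume "z \<in> direct_product affine_line S"
    then have "\<Phi> (proj1 z $ 1) (proj2 z) $ j = P j (join (vec (proj1 z $ 1)) (proj2 z))"
      by (intro eq) (simp add: mem_direct_product)
    then show "action_map \<Phi> z $ j = P j z"
      by (simp add: action_map_def join_proj flip: vec_1_eq)
  qed
qed (rule assms(1))

text \<open>Local nilpotency in concrete form: the pullback of a regular function under the flow is
  polynomial in the time, as the flow itself is.\<close>

lemma algebraic_action_expand:
  fixes S :: "(complex ^ 'n::finite) set"
  assumes S: "algebraic_set S" and \<Phi>: "algebraic_action S \<Phi>" and f: "f \<in> regular_funs S"
  shows "\<exists>Q d. (\<forall>m. polynomial_fun (\<lambda>x. coeff (Q x) m)) \<and> (\<forall>x. degree (Q x) \<le> d) \<and>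
    (\<forall>s. \<forall>x\<in>S. f (\<Phi> s x) = poly (Q x) s)"
proof -
  obtain F where F: "polynomial_fun F" "f = restr S F" using regular_funsE[OF S f] .
  obtain P :: "'n \<Rightarrow> complex ^ (1 + 'n) \<Rightarrow> complex" where P: "\<And>j. polynomial_fun (P j)"
      "\<And>t x j. x \<in> S \<Longrightarrow> \<Phi> t x $ j = P j (join (vec t) x)"
    using algebraic_action_polynomial[OF S \<Phi>] by blast
  have "polynomial_fun (\<lambda>z. F (\<chi> j. P j z))"
    by (rule polynomial_fun_comp[OF F(1)]) (simp add: P(1))
  from polynomial_fun_expand[OF this] obtain Q d where Q: "\<forall>m. polynomial_fun (\<lambda>x. coeff (Q x) m)"
      "\<forall>x. degree (Q x) \<le> d" "\<And>s x. F (\<chi> j. P j (join (vec s) x)) = poly (Q x) s" by blast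
  have "f (\<Phi> s x) = poly (Q x) s" if "x \<in> S" for s x
  proof -
    have "\<Phi> s x \<in> S" using \<Phi> that by (auto simp: algebraic_action_def additive_action_def)
    moreover have "(\<chi> j. P j (join (vec s) x)) = \<Phi> s x" by (simp add: vec_eq_iff P(2) that)
    ultimately show ?thesis using Q(3)[of s x] F(2) by (simp add: restr_def)
  qed
  then show ?thesis using Q by blast
qed


section \<open>Vector fields and their flows\<close>

lemma alg_vector_fieldD:
  assumes "alg_vector_field X D"
  shows "f \<notin> regular_funs X \<Longrightarrow> D f = (\<lambda>_. 0)"
    "f \<in> regular_funs X \<Longrightarrow> D f \<in> regular_funs X"
    "f \<in> regular_funs X \<Longrightarrow> g \<in> regular_funs X \<Longrightarrow> D (\<lambda>x. f x + g x) = (\<lambda>x. D f x + D g x)"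
    "f \<in> regular_funs X \<Longrightarrow> D (\<lambda>x. c * f x) = (\<lambda>x. c * D f x)"
    "f \<in> regular_funs X \<Longrightarrow> g \<in> regular_funs X \<Longrightarrow>
      D (\<lambda>x. f x * g x) = (\<lambda>x. f x * D g x + g x * D f x)"
  using assms unfolding alg_vector_field_def by blast+

lemma additive_actionD:
  assumes "additive_action S \<Phi>" "x \<in> S"
  shows "\<Phi> t x \<in> S" "\<Phi> 0 x = x" "\<Phi> (s + t) x = \<Phi> s (\<Phi> t x)"
  using assms unfolding additive_action_def by auto

text \<open>\<open>generates\<close> prescribes the derivative at time 0 only; the group law carries
  it to every time.\<close>

lemma generates_deriv:
  assumes "additive_action S \<Phi>" "generates X D S \<Phi>" "f \<in> regular_funs X" "x \<in> S"
  shows "((\<lambda>t. f (\<Phi> t x)) has_field_derivative D f (\<Phi> t x)) (at t)"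
proof -
  have "((\<lambda>s. f (\<Phi> s (\<Phi> t x))) has_field_derivative D f (\<Phi> t x)) (at 0)"
    using assms additive_actionD[OF assms(1,4)] unfolding generates_def by blast
  then have "((\<lambda>s. f (\<Phi> (s + t) x)) has_field_derivative D f (\<Phi> t x)) (at 0)"
    by (simp add: additive_actionD(3)[OF assms(1,4)])
  then show ?thesis using DERIV_shift[of "\<lambda>t. f (\<Phi> t x)" "D f (\<Phi> t x)" 0 t] by simp
qed

lemma flow_affine:
  assumes "additive_action S \<Phi>" "generates X D S \<Phi>" "f \<in> regular_funs X" "x \<in> S"
    and "\<And>t. D f (\<Phi> t x) = e"
  shows "f (\<Phi> t x) = f x + t * e"
proof -
  have "((\<lambda>t. f (\<Phi> t x) - t * e) has_field_derivative D f (\<Phi> t x) - 1 * e) (at t within UNIV)" for t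
    by (intro DERIV_diff generates_deriv[OF assms(1-4)] DERIV_cmult_right DERIV_ident)
  then obtain c where c: "f (\<Phi> t x) - t * e = c" for t
    using has_field_derivative_zero_constant[of UNIV "\<lambda>t. f (\<Phi> t x) - t * e"] by (auto simp: assms(5))
  show ?thesis using c[of t] c[of 0] additive_actionD(2)[OF assms(1,4)] by (simp add: diff_eq_eq)
qed

lemma flow_invariant:
  assumes "additive_action S \<Phi>" "generates X D S \<Phi>" "f \<in> regular_funs X" "x \<in> S"
    and "\<And>y. y \<in> S \<Longrightarrow> D f y = 0"
  shows "f (\<Phi> t x) = f x"
  using flow_affine[OF assms(1-4), of 0 t] assms(5) additive_actionD(1)[OF assms(1,4)] by simp

lemma flow_affine_kernel:
  assumes "additive_action S \<Phi>" "generates X D S \<Phi>" "f \<in> regular_funs X" "x \<in> S"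
    and "D f \<in> regular_funs X" "\<And>y. y \<in> S \<Longrightarrow> D (D f) y = 0"
  shows "f (\<Phi> t x) = f x + t * D f x"
  using flow_invariant[OF assms(1,2,5,4,6)] by (intro flow_affine[OF assms(1-4)])

text \<open>The derivative at time 0 is the linear coefficient of the expansion in the time, which
  is a polynomial in the point.\<close>

lemma action_derivative_regular:
  assumes X: "algebraic_set X" and \<Phi>: "algebraic_action X \<Phi>" and f: "f \<in> regular_funs X"
  shows "\<exists>g\<in>regular_funs X. \<forall>x\<in>X. ((\<lambda>t. f (\<Phi> t x)) has_field_derivative g x) (at 0)"
proof -
  obtain Q d where Q: "\<And>m. polynomial_fun (\<lambda>x. coeff (Q x) m)"
      "\<And>s x. x \<in> X \<Longrightarrow> f (\<Phi> s x) = poly (Q x) s"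
    using algebraic_action_expand[OF X \<Phi> f] by blast
  have "((\<lambda>t. f (\<Phi> t x)) has_field_derivative restr X (\<lambda>x. coeff (Q x) 1) x) (at 0)" if "x \<in> X" for x
    using poly_DERIV[of "Q x" 0]
    by (simp add: Q(2)[OF that] restr_def that poly_0_coeff_0 coeff_pderiv)
  then show ?thesis using restr_regular[OF Q(1)] by blast
qed

definition action_field ::
  "(complex ^ 'n) set \<Rightarrow> (complex \<Rightarrow> complex ^ 'n \<Rightarrow> complex ^ 'n) \<Rightarrow> 'n field_op" where
  "action_field X \<Phi> f =
    (if f \<in> regular_funs X then restr X (\<lambda>x. deriv (\<lambda>t. f (\<Phi> t x)) 0) else (\<lambda>_. 0))"

text \<open>The rules for derivatives at time 0 become the derivation laws, because derivatives are
  unique.\<close>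

lemma locally_nilpotent_action_field:
  assumes X: "algebraic_set X" and \<Phi>: "algebraic_action X \<Phi>"
  shows "locally_nilpotent_field X (action_field X \<Phi>)" "generates X (action_field X \<Phi>) X \<Phi>"
proof -
  let ?D = "action_field X \<Phi>"
  have D: "?D f \<in> regular_funs X"
      "x \<in> X \<Longrightarrow> ((\<lambda>t. f (\<Phi> t x)) has_field_derivative ?D f x) (at 0)"
    if f: "f \<in> regular_funs X" for f x
  proof -
    obtain g where g: "g \<in> regular_funs X"
        "\<And>x. x \<in> X \<Longrightarrow> ((\<lambda>t. f (\<Phi> t x)) has_field_derivative g x) (at 0)"
      using action_derivative_regular[OF X \<Phi> f] by blast
    have "?D f = g"
      using f g(1) DERIV_imp_deriv[OF g(2)] by (auto simp: action_field_def restr_def regular_funs_outside)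
    then show "?D f \<in> regular_funs X"
      "x \<in> X \<Longrightarrow> ((\<lambda>t. f (\<Phi> t x)) has_field_derivative ?D f x) (at 0)" using g by auto
  qed
  have unique: "?D f = g" if "f \<in> regular_funs X" "\<And>x. x \<notin> X \<Longrightarrow> g x = 0"
    "\<And>x. x \<in> X \<Longrightarrow> ((\<lambda>t. f (\<Phi> t x)) has_field_derivative g x) (at 0)" for f g
  proof
    fix x show "?D f x = g x"
      using D[OF that(1)] that(2,3) regular_funs_outside[of "?D f" X x]
      by (cases "x \<in> X") (auto intro: DERIV_unique)
  qed
  note out = regular_funs_outside[OF D(1)]
  have "additive_action X \<Phi>" using \<Phi> by (simp add: algebraic_action_def)
  note \<Phi>0 = additive_actionD(2)[OF this]
  have "alg_vector_field X ?D" unfolding alg_vector_field_def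
  proof (intro conjI allI impI ballI)
    fix f g c assume f: "f \<in> regular_funs X"
    show "?D (\<lambda>x. c * f x) = (\<lambda>x. c * ?D f x)"
      using f out by (intro unique regular_funs_scale[OF X] DERIV_cmult D(2)) auto
    assume g: "g \<in> regular_funs X"
    show "?D (\<lambda>x. f x + g x) = (\<lambda>x. ?D f x + ?D g x)"
      using f g out by (intro unique regular_funs_add[OF X] DERIV_add D(2)) auto
    show "?D (\<lambda>x. f x * g x) = (\<lambda>x. f x * ?D g x + g x * ?D f x)"
    proof (rule unique)
      fix x assume x: "x \<in> X"
      from DERIV_mult[OF D(2)[OF f x] D(2)[OF g x]]
      show "((\<lambda>t. f (\<Phi> t x) * g (\<Phi> t x)) has_field_derivative f x * ?D g x + g x * ?D f x) (at 0)"
        by (simp add: \<Phi>0[OF x] algebra_simps)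
    qed (use f g out in \<open>auto intro: regular_funs_mult[OF X]\<close>)
  qed (simp add: action_field_def, erule D(1))
  moreover show "generates X ?D X \<Phi>" unfolding generates_def using D(2) by blast
  ultimately show "locally_nilpotent_field X ?D" unfolding locally_nilpotent_field_def using \<Phi> by blast
qed

lemma alg_vector_field_mult:
  assumes X: "algebraic_set X" and D: "alg_vector_field X D" and a: "a \<in> regular_funs X"
  shows "alg_vector_field X (\<lambda>f x. a x * D f x)"
  unfolding alg_vector_field_def
  using alg_vector_fieldD[OF D] regular_funs_mult[OF X a alg_vector_fieldD(2)[OF D]]
  by (auto simp: algebra_simps)


section \<open>Time changes of algebraic flows\<close>

text \<open>The entire function \<open>(exp z - 1) / z\<close>, written as the difference quotient
  to which \<open>pole_lemma\<close> applies.\<close>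

definition exp_quotient :: "complex \<Rightarrow> complex" where
  "exp_quotient z = (if z = 0 then deriv exp 0 else (exp z - exp 0) / (z - 0))"

lemma exp_quotient_0 [simp]: "exp_quotient 0 = 1"
  using DERIV_imp_deriv[OF DERIV_exp, of "0::complex"] by (simp add: exp_quotient_def)

lemma exp_quotient_differentiable: "exp_quotient field_differentiable (at z)"
proof -
  have "exp_quotient holomorphic_on UNIV"
    using pole_lemma[of exp UNIV 0] holomorphic_on_exp unfolding exp_quotient_def by (simp add: fun_eq_iff)
  then show ?thesis by (auto simp: holomorphic_on_def)
qed

text \<open>Solves \<open>\<sigma>' = a + e \<sigma>\<close>, \<open>\<sigma> 0 = 0\<close>, without dividing by \<open>e\<close>, which may vanish.\<close>

definition affine_flow_time :: "complex \<Rightarrow> complex \<Rightarrow> complex \<Rightarrow> complex" where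
  "affine_flow_time a e t = a * t * exp_quotient (e * t)"

lemma affine_flow_time_0 [simp]: "affine_flow_time a e 0 = 0"
  by (simp add: affine_flow_time_def)

text \<open>After time \<open>t\<close> the initial speed \<open>a\<close> has become
  \<open>a + \<sigma> e\<close>, where \<open>\<sigma>\<close> is the solution at \<open>t\<close>;
  continuing from there for time \<open>s\<close> gives the cocycle rule. For nonzero
  \<open>e\<close> it is read off from \<open>a (exp (e t) - 1) / e\<close>.\<close>

lemma affine_flow_time_add:
  "affine_flow_time a e (s + t) =
    affine_flow_time (a + affine_flow_time a e t * e) e s + affine_flow_time a e t"
proof (cases "e = 0")
  case False
  have eq: "affine_flow_time b e t = b * (exp (e * t) - 1) / e" for b t
    using False by (cases "t = 0") (auto simp: affine_flow_time_def exp_quotient_def)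
  show ?thesis using False unfolding eq by (simp add: field_simps exp_add)
qed (simp add: affine_flow_time_def algebra_simps)

lemma affine_flow_time_deriv: "(affine_flow_time a e has_field_derivative a) (at 0)"
proof -
  obtain d where d: "(exp_quotient has_field_derivative d) (at (e * 0))"
    using exp_quotient_differentiable unfolding field_differentiable_def by blast
  have lin: "((\<lambda>t. b * t) has_field_derivative b) (at 0)" for b :: complex
    by (auto intro!: derivative_eq_intros)
  show ?thesis
    using DERIV_mult[OF lin[of a] DERIV_chain2[where g = "\<lambda>t. e * t", OF d lin]]
    by (simp add: affine_flow_time_def[abs_def])
qed

text \<open>Complex differentiability is expressed by a complex linear real derivative, as in
  \<open>holomorphic_open\<close>.\<close>

definition entire_fun :: "(complex ^ 'n \<Rightarrow> complex) \<Rightarrow> bool" where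
  "entire_fun F \<longleftrightarrow> (\<forall>x. \<exists>L. (F has_derivative L) (at x) \<and> (\<forall>c v. L (c *s v) = c * L v))"

lemma entire_fun_const: "entire_fun (\<lambda>_. c)"
  unfolding entire_fun_def by (intro allI exI[of _ "\<lambda>_. 0"]) auto

lemma entire_fun_coord: "entire_fun (\<lambda>x. x $ i)"
  unfolding entire_fun_def
  by (intro allI exI[of _ "\<lambda>x. x $ i"]) (auto intro: bounded_linear_imp_has_derivative bounded_linear_vec_nth)

lemma entire_fun_add:
  assumes "entire_fun F" "entire_fun G"
  shows "entire_fun (\<lambda>x. F x + G x)"
  unfolding entire_fun_def
proof
  fix x
  obtain L M where "(F has_derivative L) (at x)" "\<forall>c v. L (c *s v) = c * L v"
      "(G has_derivative M) (at x)" "\<forall>c v. M (c *s v) = c * M v"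
    using assms unfolding entire_fun_def by metis
  then show "\<exists>L. ((\<lambda>x. F x + G x) has_derivative L) (at x) \<and> (\<forall>c v. L (c *s v) = c * L v)"
    by (intro exI[of _ "\<lambda>v. L v + M v"]) (auto intro: has_derivative_add simp: algebra_simps)
qed

lemma entire_fun_mult:
  assumes "entire_fun F" "entire_fun G"
  shows "entire_fun (\<lambda>x. F x * G x)"
  unfolding entire_fun_def
proof
  fix x
  obtain L M where "(F has_derivative L) (at x)" "\<forall>c v. L (c *s v) = c * L v"
      "(G has_derivative M) (at x)" "\<forall>c v. M (c *s v) = c * M v"
    using assms unfolding entire_fun_def by metis
  then show "\<exists>L. ((\<lambda>x. F x * G x) has_derivative L) (at x) \<and> (\<forall>c v. L (c *s v) = c * L v)"
    using has_derivative_mult[of F L x UNIV G M]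
    by (intro exI[of _ "\<lambda>v. F x * M v + L v * G x"]) (auto simp: algebra_simps)
qed

lemma entire_fun_comp:
  assumes "entire_fun F" "\<And>z. h field_differentiable (at z)"
  shows "entire_fun (\<lambda>x. h (F x))"
  unfolding entire_fun_def
proof
  fix x
  obtain L where L: "(F has_derivative L) (at x)" "\<forall>c v. L (c *s v) = c * L v"
    using assms unfolding entire_fun_def by metis
  obtain d where "(h has_field_derivative d) (at (F x))"
    using assms(2) unfolding field_differentiable_def by blast
  then have "(h has_derivative (*) d) (at (F x))" by (simp add: has_field_derivative_def)
  from has_derivative_compose[OF L(1) this]
  show "\<exists>L. ((\<lambda>x. h (F x)) has_derivative L) (at x) \<and> (\<forall>c v. L (c *s v) = c * L v)"
    using L(2) by (intro exI[of _ "\<lambda>v. d * L v"]) auto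
qed

lemma entire_fun_polynomial:
  assumes "polynomial_fun p" "\<And>j. entire_fun (\<lambda>x. G x $ j)"
  shows "entire_fun (\<lambda>x. p (G x))"
  using assms(1)
  by induction (auto intro: entire_fun_const assms(2) entire_fun_add entire_fun_mult)

text \<open>Along a flow line of \<open>D\<close> the function \<open>a\<close> is affine in the time, so \<open>a D\<close> has the same flow
  lines, run through with a time change by an affine differential equation.\<close>

lemma complete_field_mult:
  fixes X :: "(complex ^ 'n::finite) set"
  assumes X: "algebraic_set X" and D: "locally_nilpotent_field X D" and a: "a \<in> regular_funs X"
    and DDa: "D (D a) = (\<lambda>_. 0)"
  shows "complete_field X (\<lambda>f x. a x * D f x)"
proof -
  obtain \<Phi> where \<Phi>: "algebraic_action X \<Phi>" "generates X D X \<Phi>" and vf: "alg_vector_field X D"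
    using D unfolding locally_nilpotent_field_def by blast
  have add: "additive_action X \<Phi>" using \<Phi>(1) by (simp add: algebraic_action_def)
  note \<Phi>D = additive_actionD[OF add]
  have Da: "D a \<in> regular_funs X" by (rule alg_vector_fieldD(2)[OF vf a])
  have a_flow: "a (\<Phi> t x) = a x + t * D a x" if "x \<in> X" for t x
    by (rule flow_affine_kernel[OF add \<Phi>(2) a that Da]) (simp add: DDa)
  have e_flow: "D a (\<Phi> t x) = D a x" if "x \<in> X" for t x
    by (rule flow_invariant[OF add \<Phi>(2) Da that]) (simp add: DDa)
  \<comment> \<open>At flow time \<open>\<sigma>\<close> the function \<open>a\<close> has the value
    \<open>a x + \<sigma> * D a x\<close>, so running at speed \<open>a\<close> means solving
    \<open>\<sigma>' = a x + D a x * \<sigma>\<close>.\<close>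
  define \<Psi> where "\<Psi> t x = \<Phi> (affine_flow_time (a x) (D a x) t) x" for t x
  have \<Psi>: "additive_action X \<Psi>" unfolding additive_action_def
  proof (intro conjI allI ballI)
    fix x s t assume x: "x \<in> X"
    show "\<Psi> t x \<in> X" "\<Psi> 0 x = x" using \<Phi>D(1,2)[OF x] by (simp_all add: \<Psi>_def)
    show "\<Psi> (s + t) x = \<Psi> s (\<Psi> t x)"
      unfolding \<Psi>_def affine_flow_time_add \<Phi>D(3)[OF x] by (simp add: a_flow[OF x] e_flow[OF x])
  qed
  obtain P :: "'n \<Rightarrow> complex ^ (1 + 'n) \<Rightarrow> complex" where P: "\<And>j. polynomial_fun (P j)"
      "\<And>t x j. x \<in> X \<Longrightarrow> \<Phi> t x $ j = P j (join (vec t) x)"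
    using algebraic_action_polynomial[OF X \<Phi>(1)] by blast
  obtain A E where A: "polynomial_fun A" "a = restr X A" and E: "polynomial_fun E" "D a = restr X E"
    using regular_funsE[OF X a] regular_funsE[OF X Da] by metis
  have "holomorphic_map (direct_product affine_line X) X (action_map \<Psi>)"
    unfolding holomorphic_map_def
  proof (intro conjI allI ballI)
    show "action_map \<Psi> ` direct_product affine_line X \<subseteq> X"
      using additive_actionD(1)[OF \<Psi>] by (auto simp: mem_direct_product action_map_def)
    fix j and z :: "complex ^ (1 + 'n)"
    \<comment> \<open>The same time change with \<open>a\<close> and \<open>D a\<close> replaced by
      the polynomials \<open>A\<close> and \<open>E\<close>, which makes it entire on the ambient
      space.\<close>
    let ?\<sigma> = "\<lambda>z :: complex ^ (1 + 'n). A (proj2 z) * z $ Inl 1 * exp_quotient (E (proj2 z) * z $ Inl 1)"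
    let ?F = "\<lambda>z. P j (join (vec (?\<sigma> z)) (proj2 z))"
    have proj: "entire_fun (\<lambda>z :: complex ^ (1 + 'n). proj2 z $ i)" for i
      by (simp add: proj2_def entire_fun_coord)
    have \<sigma>: "entire_fun ?\<sigma>"
      by (intro entire_fun_mult entire_fun_comp[OF _ exp_quotient_differentiable]
          entire_fun_coord entire_fun_polynomial[OF A(1)] entire_fun_polynomial[OF E(1)] proj)
    have "entire_fun ?F"
    proof (rule entire_fun_polynomial[OF P(1)])
      fix i show "entire_fun (\<lambda>z. join (vec (?\<sigma> z)) (proj2 z) $ i)"
        using \<sigma> proj by (cases i) auto
    qed
    then have "holomorphic_open UNIV ?F" by (simp add: holomorphic_open_def entire_fun_def)
    moreover have "action_map \<Psi> y $ j = ?F y" if "y \<in> direct_product affine_line X" for y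
    proof -
      have y: "proj2 y \<in> X" using that by (simp add: mem_direct_product)
      have "proj1 y $ 1 = y $ Inl 1" by (simp add: proj1_def)
      moreover have "a (proj2 y) = A (proj2 y)" "D a (proj2 y) = E (proj2 y)"
        using fun_cong[OF A(2), of "proj2 y"] fun_cong[OF E(2), of "proj2 y"] y
        by (simp_all add: restr_def)
      ultimately show ?thesis
        using y by (simp add: action_map_def \<Psi>_def P(2) affine_flow_time_def)
    qed
    ultimately show "\<exists>U F. z \<in> U \<and> holomorphic_open U F \<and>
        (\<forall>y\<in>direct_product affine_line X \<inter> U. action_map \<Psi> y $ j = F y)"
      by (intro exI[of _ UNIV] exI[of _ ?F]) auto
  qed
  moreover have "generates X (\<lambda>f x. a x * D f x) X \<Psi>" unfolding generates_def
  proof (intro ballI)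
    fix f x assume f: "f \<in> regular_funs X" and x: "x \<in> X"
    have "((\<lambda>t. f (\<Phi> t x)) has_field_derivative D f x) (at (affine_flow_time (a x) (D a x) 0))"
      using generates_deriv[OF add \<Phi>(2) f x, of 0] by (simp add: \<Phi>D(2)[OF x])
    from DERIV_chain2[OF this affine_flow_time_deriv]
    show "((\<lambda>t. f (\<Psi> t x)) has_field_derivative a x * D f x) (at 0)"
      by (simp add: \<Psi>_def mult.commute)
  qed
  ultimately show ?thesis
    using alg_vector_field_mult[OF X vf a] \<Psi> unfolding complete_field_def holomorphic_action_def by blast
qed

text \<open>With \<open>D = \<xi>\<close> and \<open>E = \<eta>\<close> this is \<open>[f \<xi>, a g \<eta>] - [a f \<xi>, g \<eta>] = \<xi>(a) f g \<eta>\<close>.\<close>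

lemma bracket_in_Lie_alg:
  assumes X: "algebraic_set X"
    and D: "locally_nilpotent_field X D" and E: "locally_nilpotent_field X E"
    and reg: "a \<in> regular_funs X" "f \<in> regular_funs X" "g \<in> regular_funs X"
    and ker: "D f = (\<lambda>_. 0)" "D (D a) = (\<lambda>_. 0)" "E a = (\<lambda>_. 0)" "E g = (\<lambda>_. 0)"
  shows "(\<lambda>h x. D a x * f x * g x * E h x) \<in> Lie_alg X"
proof -
  have vD: "alg_vector_field X D" and vE: "alg_vector_field X E"
    using D E by (auto simp: locally_nilpotent_field_def)
  note L = alg_vector_fieldD(5)[OF vD] alg_vector_fieldD(5)[OF vE]
  note R = alg_vector_fieldD(2)[OF vD] alg_vector_fieldD(2)[OF vE] regular_funs_mult[OF X]
  have zero: "(\<lambda>_. 0) \<in> regular_funs X" using regular_funs_const[OF X, of 0] by (simp add: restr_def)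
  have D0: "D (\<lambda>_. 0) = (\<lambda>_. 0)" and E0: "E (\<lambda>_. 0) = (\<lambda>_. 0)"
    using alg_vector_fieldD(4)[OF vD zero, of 0] alg_vector_fieldD(4)[OF vE zero, of 0] by simp_all
  \<comment> \<open>Completeness of a multiple requires the multiplier to be killed by the second
    power of the field; here \<open>D f = 0\<close> leaves \<open>f * D (D a)\<close>.\<close>
  have "D (D (\<lambda>x. a x * f x)) = (\<lambda>_. 0)"
    using ker reg R by (simp add: L)
  then have 1: "(\<lambda>h x. (a x * f x) * D h x) \<in> Lie_alg X"
    by (intro Lie_alg.complete complete_field_mult[OF X D] R reg)
  have 2: "(\<lambda>h x. f x * D h x) \<in> Lie_alg X"
    using ker D0 by (intro Lie_alg.complete complete_field_mult[OF X D] reg) simp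
  have 3: "(\<lambda>h x. g x * E h x) \<in> Lie_alg X"
    using ker E0 by (intro Lie_alg.complete complete_field_mult[OF X E] reg) simp
  have "E (E (\<lambda>x. a x * g x)) = (\<lambda>_. 0)"
    using ker reg R E0 by (simp add: L)
  then have 4: "(\<lambda>h x. (a x * g x) * E h x) \<in> Lie_alg X"
    by (intro Lie_alg.complete complete_field_mult[OF X E] R reg)
  have Dh: "D h \<in> regular_funs X" and Eh: "E h \<in> regular_funs X" for h
    using R(1,2) alg_vector_fieldD(1)[OF vD] alg_vector_fieldD(1)[OF vE] zero by metis+
  \<comment> \<open>The second order terms cancel inside each bracket. The terms with
    \<open>D g\<close> and \<open>E f\<close> occur in both brackets and cancel in the difference,
    which leaves only the term with \<open>D a\<close>.\<close>
  have "(\<lambda>h x. D a x * f x * g x * E h x) =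
    (\<lambda>h x. (f x * D (\<lambda>x. (a x * g x) * E h x) x - (a x * g x) * E (\<lambda>x. f x * D h x) x) +
      (-1) * ((a x * f x) * D (\<lambda>x. g x * E h x) x - g x * E (\<lambda>x. (a x * f x) * D h x) x))"
    using reg Dh Eh R(3) ker by (simp add: L fun_eq_iff) (simp add: algebra_simps)
  then show ?thesis
    using Lie_alg.add[OF Lie_alg.bracket[OF 2 4] Lie_alg.scale[OF Lie_alg.bracket[OF 1 3], of "-1"]]
    by simp
qed


section \<open>Fields with a slice\<close>

lemma field_zeroI:
  assumes "alg_vector_field X D" "generates X D X \<Phi>" "g \<in> regular_funs X"
    and "\<And>t x. x \<in> X \<Longrightarrow> g (\<Phi> t x) = g x"
  shows "D g = (\<lambda>_. 0)"
proof
  fix x show "D g x = 0"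
  proof (cases "x \<in> X")
    case True
    then have "((\<lambda>t. g (\<Phi> t x)) has_field_derivative D g x) (at 0)"
      using assms(2,3) unfolding generates_def by blast
    then show ?thesis using assms(4)[OF True] DERIV_unique[OF _ DERIV_const] by auto
  next
    case False
    then show ?thesis using regular_funs_outside[OF alg_vector_fieldD(2)[OF assms(1,3)]] by blast
  qed
qed

section \<open>Kernels of vector fields and sums in the Lie algebra\<close>

lemma kernel_mult:
  assumes "alg_vector_field X D" "f \<in> regular_funs X" "g \<in> regular_funs X"
    "D f = (\<lambda>_. 0)" "D g = (\<lambda>_. 0)"
  shows "D (\<lambda>x. f x * g x) = (\<lambda>_. 0)"
  by (simp add: alg_vector_fieldD(5)[OF assms(1-3)] assms(4,5))

lemma kernel_one:
  assumes X: "algebraic_set X" and D: "alg_vector_field X D"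
  shows "D (restr X (\<lambda>_. 1)) = (\<lambda>_. 0)"
proof -
  let ?e = "restr X (\<lambda>_. 1)"
  have e: "?e \<in> regular_funs X" by (rule regular_funs_const[OF X])
  \<comment> \<open>The Leibniz rule for \<open>1 * 1 = 1\<close> yields
    \<open>D 1 = 2 * D 1\<close> on \<open>X\<close>.\<close>
  have "(\<lambda>x. ?e x * ?e x) = ?e" by (auto simp: restr_def)
  then have *: "D ?e x = ?e x * D ?e x + ?e x * D ?e x" for x
    using fun_cong[OF alg_vector_fieldD(5)[OF D e e], of x] by simp
  show ?thesis
  proof
    fix x show "D ?e x = 0"
      using *[of x] regular_funs_outside[OF alg_vector_fieldD(2)[OF D e], of x]
      by (cases "x \<in> X") (auto simp: restr_def)
  qed
qed

lemma kernel_power: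
  assumes X: "algebraic_set X" and D: "alg_vector_field X D" and f: "f \<in> regular_funs X" "D f = (\<lambda>_. 0)"
  shows "D (restr X (\<lambda>x. f x ^ n)) = (\<lambda>_. 0)"
proof (induction n)
  case 0
  show ?case using kernel_one[OF X D] by simp
next
  case (Suc n)
  have "restr X (\<lambda>x. f x ^ Suc n) = (\<lambda>x. f x * restr X (\<lambda>x. f x ^ n) x)"
    by (auto simp: restr_def)
  then show ?case using kernel_mult[OF D f(1) regular_funs_power[OF X f(1)] f(2) Suc] by simp
qed

lemma Lie_alg_sum:
  assumes "D \<in> Lie_alg X" "\<And>i. i \<in> I \<Longrightarrow> (\<lambda>f x. E i f x) \<in> Lie_alg X"
  shows "(\<lambda>f x. \<Sum>i\<in>I. E i f x) \<in> Lie_alg X"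
proof -
  have z: "(\<lambda>f x. 0) \<in> Lie_alg X" using Lie_alg.scale[OF assms(1), of 0] by simp
  show ?thesis using assms(2)
    by (induction I rule: infinite_finite_induct) (auto intro: z Lie_alg.add)
qed

text \<open>Completeness comes from \<open>complete_field_mult\<close> with multiplier 1.\<close>

lemma locally_nilpotent_in_Lie_alg:
  assumes X: "algebraic_set X" and D: "locally_nilpotent_field X D"
  shows "D \<in> Lie_alg X"
proof -
  have v: "alg_vector_field X D" using D by (simp add: locally_nilpotent_field_def)
  let ?e = "restr X (\<lambda>_. 1)"
  have e: "?e \<in> regular_funs X" by (rule regular_funs_const[OF X])
  have "D (\<lambda>_. 0) = (\<lambda>_. 0)" using alg_vector_fieldD(4)[OF v e, of 0] by simp
  then have "complete_field X (\<lambda>f x. ?e x * D f x)"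
    using kernel_one[OF X v] by (intro complete_field_mult[OF X D e]) simp
  moreover have "?e x * D f x = D f x" for f x
  proof (cases "f \<in> regular_funs X")
    case True
    then show ?thesis using regular_funs_outside[OF alg_vector_fieldD(2)[OF v True], of x]
      by (auto simp: restr_def)
  qed (simp add: alg_vector_fieldD(1)[OF v])
  ultimately show ?thesis using Lie_alg.complete by simp
qed

lemma poly_eq_sum_atMost:
  fixes p :: "'a::comm_semiring_1 poly"
  assumes "degree p \<le> d"
  shows "poly p x = (\<Sum>i\<le>d. coeff p i * x ^ i)"
  unfolding poly_altdef
  by (rule sum.mono_neutral_left) (use assms in \<open>auto simp: coeff_eq_0\<close>)

text \<open>The function \<open>t = a / u\<^sup>N\<close> satisfies \<open>\<xi> t = 1\<close> where \<open>u \<noteq> 0\<close>. Writing \<open>f\<close> at \<open>x\<close> through the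
  Taylor expansion of the flow at the point \<open>\<Phi> (- t x) x\<close> of the slice \<open>t = 0\<close> expresses \<open>f\<close> as a
  polynomial in \<open>t\<close> with \<open>\<xi>\<close>-invariant coefficients.\<close>

lemma slice_expansion:
  fixes X :: "(complex ^ 'n::finite) set"
  assumes X: "algebraic_set X" and \<xi>: "locally_nilpotent_field X \<xi>"
    and u: "u \<in> regular_funs X" and a: "a \<in> regular_funs X"
    and \<xi>u: "\<xi> u = (\<lambda>_. 0)" and \<xi>a: "\<xi> a = restr X (\<lambda>x. u x ^ N)"
    and f: "f \<in> regular_funs X"
  shows "\<exists>n d G. (\<forall>m. G m \<in> regular_funs X \<and> \<xi> (G m) = (\<lambda>_. 0)) \<and>
    (\<forall>x. u x ^ n * f x = (\<Sum>m\<le>d. G m x * (a x ^ m * u x ^ (N * (d - m)))))"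
proof -
  obtain \<Phi> where \<Phi>: "algebraic_action X \<Phi>" "generates X \<xi> X \<Phi>" and vf: "alg_vector_field X \<xi>"
    using \<xi> unfolding locally_nilpotent_field_def by blast
  have add: "additive_action X \<Phi>" using \<Phi>(1) by (simp add: algebraic_action_def)
  note \<Phi>D = additive_actionD[OF add]
  have u_flow: "u (\<Phi> t x) = u x" if "x \<in> X" for t x
    by (rule flow_invariant[OF add \<Phi>(2) u that]) (simp add: \<xi>u)
  have \<xi>\<xi>a: "\<xi> (\<xi> a) = (\<lambda>_. 0)" unfolding \<xi>a by (rule kernel_power[OF X vf u \<xi>u])
  have a_flow: "a (\<Phi> t x) = a x + t * u x ^ N" if "x \<in> X" for t x
    using flow_affine_kernel[OF add \<Phi>(2) a that alg_vector_fieldD(2)[OF vf a], of t] \<xi>\<xi>a that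
    by (simp add: \<xi>a restr_def)
  obtain Q d where Q: "\<And>m. polynomial_fun (\<lambda>x. coeff (Q x) m)" "\<And>x. degree (Q x) \<le> d"
      "\<And>s x. x \<in> X \<Longrightarrow> f (\<Phi> s x) = poly (Q x) s"
    using algebraic_action_expand[OF X \<Phi>(1) f] by blast
  define c where "c m = restr X (\<lambda>x. coeff (Q x) m)" for m
  have c: "c m \<in> regular_funs X" for m unfolding c_def by (rule restr_regular[OF Q(1)])
  have f_flow: "f (\<Phi> s x) = (\<Sum>m\<le>d. c m x * s ^ m)" if "x \<in> X" for s x
    using poly_eq_sum_atMost[OF Q(2), of x s] that by (simp add: Q(3) c_def restr_def)
  \<comment> \<open>The coefficients \<open>c m\<close> are expanded along the flow as well, since
    they will be evaluated at slice points \<open>\<Phi> (- t x) x\<close>.\<close>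
  have "\<forall>m. \<exists>Q d. (\<forall>l. polynomial_fun (\<lambda>x. coeff (Q x) l)) \<and> (\<forall>x. degree (Q x) \<le> d) \<and>
      (\<forall>s. \<forall>x\<in>X. c m (\<Phi> s x) = poly (Q x) s)"
    using algebraic_action_expand[OF X \<Phi>(1) c] by blast
  then obtain R e where R: "\<And>m l. polynomial_fun (\<lambda>x. coeff (R m x) l)" "\<And>m x. degree (R m x) \<le> e m"
      "\<And>m s x. x \<in> X \<Longrightarrow> c m (\<Phi> s x) = poly (R m x) s" by metis
  obtain A U where A: "polynomial_fun A" "a = restr X A" and U: "polynomial_fun U" "u = restr X U"
    using regular_funsE[OF X a] regular_funsE[OF X u] by metis
  define t where "t x = a x / u x ^ N" for x
  \<comment> \<open>\<open>K\<close> exceeds \<open>N * l\<close> for all \<open>l \<le> e m\<close>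
    and \<open>m \<le> d\<close>, so \<open>u ^ K\<close> clears the denominators of the powers of
    \<open>t\<close>. The \<open>Suc\<close> leaves a positive power of \<open>u\<close>, so the
    polynomial formula is 0 where \<open>u = 0\<close>.\<close>
  define K where "K = Suc (N * (\<Sum>m\<le>d. e m))"
  \<comment> \<open>The coefficient \<open>c m\<close> at the slice point of the orbit through
    \<open>x\<close>, cleared of denominators; the value 0 for \<open>u x = 0\<close> agrees with
    the polynomial formula.\<close>
  define G where "G m x = (if x \<in> X \<and> m \<le> d \<and> u x \<noteq> 0 then u x ^ K * c m (\<Phi> (- t x) x) else 0)" for m x
  have G_regular: "G m \<in> regular_funs X" for m
  proof (cases "m \<le> d")
    case True
    then have "e m \<le> (\<Sum>m\<le>d. e m)" by (intro member_le_sum) auto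
    then have K: "N * l < K" if "l \<le> e m" for l
      unfolding K_def less_Suc_eq_le using mult_le_mono2[OF order_trans[OF that]] by blast
    let ?P = "\<lambda>x. \<Sum>l\<le>e m. coeff (R m x) l * (- A x) ^ l * U x ^ (K - N * l)"
    show ?thesis
    proof (rule regular_funsI[of ?P])
      show "polynomial_fun ?P"
        by (intro polynomial_fun_sum polynomial_fun.mult polynomial_fun_power polynomial_fun_uminus A U R)
      fix x assume x: "x \<in> X"
      have AU: "A x = a x" "U x = u x" using x A U by (simp_all add: restr_def)
      show "G m x = ?P x"
      proof (cases "u x = 0")
        case True
        have "?P x = 0" using K True AU by (intro sum.neutral ballI) simp
        then show ?thesis using True by (simp add: G_def)
      next
        case False
        have summand: "u x ^ K * (coeff (R m x) l * (- t x) ^ l) =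
            coeff (R m x) l * (- A x) ^ l * U x ^ (K - N * l)" if "l \<le> e m" for l
        proof -
          have "u x ^ K = (u x ^ N) ^ l * u x ^ (K - N * l)"
            using K[OF that] by (simp flip: power_add power_mult)
          moreover have "(- t x) ^ l * (u x ^ N) ^ l = (- a x) ^ l"
            using False by (simp add: t_def flip: power_mult_distrib)
          ultimately show ?thesis unfolding AU by (simp add: mult_ac)
        qed
        have "c m (\<Phi> (- t x) x) = (\<Sum>l\<le>e m. coeff (R m x) l * (- t x) ^ l)"
          unfolding R(3)[OF x] by (rule poly_eq_sum_atMost[OF R(2)])
        then have "G m x = (\<Sum>l\<le>e m. u x ^ K * (coeff (R m x) l * (- t x) ^ l))"
          using True False x by (simp add: G_def sum_distrib_left)
        also have "\<dots> = ?P x" by (rule sum.cong[OF refl], rule summand) simp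
        finally show ?thesis .
      qed
    qed (simp add: G_def)
  next
    case False
    then have "G m = restr X (\<lambda>_. 0)" by (auto simp: G_def restr_def)
    then show ?thesis using regular_funs_const[OF X] by simp
  qed
  moreover have "\<xi> (G m) = (\<lambda>_. 0)" for m
  proof (rule field_zeroI[OF vf \<Phi>(2) G_regular])
    fix s x assume x: "x \<in> X"
    \<comment> \<open>Moving for time \<open>s\<close> raises \<open>t\<close> by \<open>s\<close>,
      so the slice point stays the same.\<close>
    have "\<Phi> (- t (\<Phi> s x)) (\<Phi> s x) = \<Phi> (- t x) x" if "u x \<noteq> 0"
    proof -
      have "t (\<Phi> s x) = t x + s" using that by (simp add: t_def a_flow[OF x] u_flow[OF x] field_simps)
      then show ?thesis using \<Phi>D(3)[OF x, of "- t (\<Phi> s x)" s] by simp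
    qed
    then show "G m (\<Phi> s x) = G m x" using \<Phi>D(1)[OF x] x by (simp add: G_def u_flow[OF x])
  qed
  \<comment> \<open>The additional exponent \<open>N * d\<close> turns each \<open>t ^ m\<close>
    with \<open>m \<le> d\<close> into \<open>a ^ m\<close> times a power of
    \<open>u\<close>.\<close>
  moreover have "u x ^ (K + N * d) * f x = (\<Sum>m\<le>d. G m x * (a x ^ m * u x ^ (N * (d - m))))" for x
  proof (cases "x \<in> X \<and> u x \<noteq> 0")
    case True
    have "\<Phi> (t x) (\<Phi> (- t x) x) = x" using True \<Phi>D(2)[of x] \<Phi>D(3)[of x "t x" "- t x"] by simp
    then have "f x = (\<Sum>m\<le>d. c m (\<Phi> (- t x) x) * t x ^ m)"
      using f_flow[OF \<Phi>D(1), of x "t x" "- t x"] True by simp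
    then have "u x ^ (K + N * d) * f x =
        (\<Sum>m\<le>d. u x ^ (K + N * d) * (c m (\<Phi> (- t x) x) * t x ^ m))" by (simp add: sum_distrib_left)
    moreover have t_pow: "u x ^ (K + N * d) * t x ^ m = u x ^ K * (a x ^ m * u x ^ (N * (d - m)))" if "m \<le> d" for m
    proof -
      have "N * d = N * m + N * (d - m)" using that by (simp flip: distrib_left)
      then have "u x ^ (N * d) = (u x ^ N) ^ m * u x ^ (N * (d - m))" by (simp add: power_add power_mult)
      moreover have "t x ^ m * (u x ^ N) ^ m = a x ^ m"
        using True by (simp add: t_def flip: power_mult_distrib)
      ultimately show ?thesis unfolding power_add by (simp add: mult_ac)
    qed
    have "u x ^ (K + N * d) * (c m (\<Phi> (- t x) x) * t x ^ m) = G m x * (a x ^ m * u x ^ (N * (d - m)))"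
      if "m \<le> d" for m
      using True that t_pow[OF that] by (simp add: G_def mult.left_commute[of "u x ^ (K + N * d)"])
    ultimately show ?thesis by simp
  next
    case False
    then have "u x = 0" using regular_funs_outside[OF u] by blast
    then show ?thesis using False by (auto simp: G_def K_def)
  qed
  ultimately show ?thesis by blast
qed

text \<open>Each term of \<open>slice_expansion\<close> is the product of a \<xi>-invariant
  \<open>G m\<close> and a function killed by \<eta>, as \<open>bracket_in_Lie_alg\<close> demands.
  The bracket contributes \<open>\<xi> a = u ^ N\<close>, whence the exponent
  \<open>N + n\<close>.\<close>

lemma slice_multiples_in_Lie_alg:
  assumes X: "algebraic_set X" and \<xi>: "locally_nilpotent_field X \<xi>" and \<eta>: "locally_nilpotent_field X \<eta>"
    and u: "u \<in> regular_funs X" and a: "a \<in> regular_funs X"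
    and \<xi>u: "\<xi> u = (\<lambda>_. 0)" and \<xi>a: "\<xi> a = restr X (\<lambda>x. u x ^ N)"
    and \<eta>u: "\<eta> u = (\<lambda>_. 0)" and \<eta>a: "\<eta> a = (\<lambda>_. 0)"
    and f: "f \<in> regular_funs X"
  shows "\<exists>n. \<forall>h\<in>regular_funs X. \<eta> h = (\<lambda>_. 0) \<longrightarrow> (\<lambda>g x. h x * u x ^ n * f x * \<eta> g x) \<in> Lie_alg X"
proof -
  have v\<xi>: "alg_vector_field X \<xi>" and v\<eta>: "alg_vector_field X \<eta>"
    using \<xi> \<eta> by (auto simp: locally_nilpotent_field_def)
  obtain n d G where G: "\<And>m. G m \<in> regular_funs X" "\<And>m. \<xi> (G m) = (\<lambda>_. 0)"
      "\<And>x. u x ^ n * f x = (\<Sum>m\<le>d. G m x * (a x ^ m * u x ^ (N * (d - m))))"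
    using slice_expansion[OF X \<xi> u a \<xi>u \<xi>a f] by blast
  have "(\<lambda>g x. h x * u x ^ (N + n) * f x * \<eta> g x) \<in> Lie_alg X"
    if h: "h \<in> regular_funs X" "\<eta> h = (\<lambda>_. 0)" for h
  proof -
    let ?p = "\<lambda>m. restr X (\<lambda>x. a x ^ m)" and ?q = "\<lambda>m. restr X (\<lambda>x. u x ^ (N * (d - m)))"
    have "\<xi> (\<xi> a) = (\<lambda>_. 0)" unfolding \<xi>a by (rule kernel_power[OF X v\<xi> u \<xi>u])
    then have "(\<lambda>g x. \<xi> a x * G m x * (h x * (?p m x * ?q m x)) * \<eta> g x) \<in> Lie_alg X" for m
      by (intro bracket_in_Lie_alg[OF X \<xi> \<eta> a] G kernel_mult[OF v\<eta>] kernel_power[OF X v\<eta>]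
          regular_funs_mult[OF X] regular_funs_power[OF X] h u a \<eta>u \<eta>a)
    moreover have "\<eta> \<in> Lie_alg X"
      by (rule locally_nilpotent_in_Lie_alg[OF X \<eta>])
    ultimately have "(\<lambda>g x. \<Sum>m\<le>d. \<xi> a x * G m x * (h x * (?p m x * ?q m x)) * \<eta> g x) \<in> Lie_alg X"
      by (intro Lie_alg_sum)
    moreover have "(\<Sum>m\<le>d. \<xi> a x * G m x * (h x * (?p m x * ?q m x)) * \<eta> g x) =
      h x * u x ^ (N + n) * f x * \<eta> g x" for g x
    proof (cases "x \<in> X")
      case True
      have "h x * u x ^ (N + n) * f x * \<eta> g x = h x * u x ^ N * \<eta> g x * (u x ^ n * f x)"
        by (simp add: power_add)
      then show ?thesis using True unfolding G(3)
        by (simp add: \<xi>a restr_def sum_distrib_left mult_ac)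
    next
      case False
      then show ?thesis using regular_funs_outside[OF h(1)] by simp
    qed
    ultimately show ?thesis by simp
  qed
  then show ?thesis by blast
qed

text \<open>Polynomials agreeing on \<open>B\<close> with a combination of the
  \<open>\<alpha> i ^ n i\<close> form an ideal. It has no zero on \<open>B\<close>, as it contains
  polynomials representing these powers, and none off \<open>B\<close>, as it contains all
  polynomials vanishing on \<open>B\<close>. The Nullstellensatz then puts 1 into it.\<close>

lemma partition_of_unity:
  fixes B :: "(complex ^ 'm::finite) set"
  assumes B: "algebraic_set B" and I: "finite I" and \<alpha>: "\<And>i. i \<in> I \<Longrightarrow> \<alpha> i \<in> regular_funs B"
    and nz: "\<And>b. b \<in> B \<Longrightarrow> \<exists>i\<in>I. \<alpha> i b \<noteq> 0"
  shows "\<exists>h. (\<forall>i. h i \<in> regular_funs B) \<and> (\<forall>b\<in>B. (\<Sum>i\<in>I. h i b * \<alpha> i b ^ n i) = 1)"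
proof -
  have "\<forall>i\<in>I. \<exists>P. polynomial_fun P \<and> \<alpha> i = restr B P"
    using regular_funsE[OF B \<alpha>] by metis
  then obtain A where A: "\<And>i. i \<in> I \<Longrightarrow> polynomial_fun (A i)" "\<And>i. i \<in> I \<Longrightarrow> \<alpha> i = restr B (A i)"
    by metis
  define J where "J = {r. polynomial_fun r \<and>
    (\<exists>c. (\<forall>i. polynomial_fun (c i)) \<and> (\<forall>b\<in>B. r b = (\<Sum>i\<in>I. c i b * \<alpha> i b ^ n i)))}"
  have JI: "r \<in> J" if "polynomial_fun r" "\<And>i. polynomial_fun (c i)"
      "\<And>b. b \<in> B \<Longrightarrow> r b = (\<Sum>i\<in>I. c i b * \<alpha> i b ^ n i)" for r c
    using that unfolding J_def by blast
  have "polynomial_ideal J" unfolding polynomial_ideal_def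
  proof (intro conjI ballI allI impI)
    show "J \<subseteq> Collect polynomial_fun" unfolding J_def by blast
    show "(\<lambda>_. 0) \<in> J" by (rule JI[of _ "\<lambda>_ _. 0"]) (simp_all add: polynomial_fun.const)
  next
    fix p q assume "p \<in> J" "q \<in> J"
    then obtain c d where p: "polynomial_fun p" "\<And>i. polynomial_fun (c i)"
        "\<And>b. b \<in> B \<Longrightarrow> p b = (\<Sum>i\<in>I. c i b * \<alpha> i b ^ n i)"
      and q: "polynomial_fun q" "\<And>i. polynomial_fun (d i)"
        "\<And>b. b \<in> B \<Longrightarrow> q b = (\<Sum>i\<in>I. d i b * \<alpha> i b ^ n i)" unfolding J_def by blast
    show "(\<lambda>x. p x + q x) \<in> J"
      by (rule JI[of _ "\<lambda>i b. c i b + d i b"])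
        (simp_all add: polynomial_fun.add p q sum.distrib distrib_right)
  next
    fix p and q :: "complex ^ 'm \<Rightarrow> complex" assume "p \<in> J" and q: "polynomial_fun q"
    then obtain c where p: "polynomial_fun p" "\<And>i. polynomial_fun (c i)"
        "\<And>b. b \<in> B \<Longrightarrow> p b = (\<Sum>i\<in>I. c i b * \<alpha> i b ^ n i)" unfolding J_def by blast
    show "(\<lambda>x. q x * p x) \<in> J"
      by (rule JI[of _ "\<lambda>i b. q b * c i b"])
        (simp_all add: polynomial_fun.mult p q sum_distrib_left mult.assoc)
  qed
  moreover have "(1::complex) = 0" if z: "\<And>p. p \<in> J \<Longrightarrow> p z = 0" for z
  proof (cases "z \<in> B")
    case True
    then obtain i where i: "i \<in> I" "\<alpha> i z \<noteq> 0" using nz by blast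
    have "(\<lambda>x. A i x ^ n i) \<in> J"
    proof (rule JI[of _ "\<lambda>j _. if j = i then 1 else 0"])
      fix b assume b: "b \<in> B"
      have "(\<Sum>j\<in>I. (if j = i then 1 else 0) * \<alpha> j b ^ n j) = (\<Sum>j\<in>I. if j = i then \<alpha> i b ^ n i else 0)"
        by (rule sum.cong) auto
      then show "A i b ^ n i = (\<Sum>j\<in>I. (if j = i then 1 else 0) * \<alpha> j b ^ n j)"
        using I i(1) b by (simp add: A(2) restr_def)
    qed (auto intro: polynomial_fun.const polynomial_fun_power A i)
    then show ?thesis using z[of "\<lambda>x. A i x ^ n i"] i True by (simp add: A(2) restr_def)
  next
    case False
    then obtain p where p: "polynomial_fun p" "p z \<noteq> 0" "\<forall>y\<in>B. p y = 0"
      using B unfolding algebraic_set_def by blast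
    have "p \<in> J" by (rule JI[of _ "\<lambda>_ _. 0"]) (simp_all add: p polynomial_fun.const)
    then show ?thesis using z p(2) by blast
  qed
  ultimately have "\<exists>k. (\<lambda>x. 1 ^ k) \<in> J"
    by (intro nullstellensatz polynomial_fun.const) auto
  then obtain c where "\<And>i. polynomial_fun (c i)" "\<forall>b\<in>B. (\<Sum>i\<in>I. c i b * \<alpha> i b ^ n i) = 1"
    unfolding J_def by auto
  then show ?thesis
    by (intro exI[of _ "\<lambda>i. restr B (c i)"]) (auto simp: restr_regular, simp add: restr_def)
qed

lemma pullback_regular:
  assumes "algebraic_set X" "algebraic_set B" "regular_map X B \<pi>" "h \<in> regular_funs B"
  shows "pullback X \<pi> h \<in> regular_funs X"
proof -
  obtain H where H: "polynomial_fun H" "h = restr B H" using regular_funsE[OF assms(2,4)] .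
  have "\<forall>j. \<exists>P. polynomial_fun P \<and> (\<forall>x\<in>X. \<pi> x $ j = P x)"
    using assms(3) unfolding regular_map_def by (intro allI regular_on_polynomial[OF assms(1)]) blast
  then obtain P where P: "\<And>j. polynomial_fun (P j)" "\<And>j x. x \<in> X \<Longrightarrow> \<pi> x $ j = P j x" by metis
  show ?thesis
  proof (rule regular_funsI[of "\<lambda>x. H (\<chi> j. P j x)"])
    show "polynomial_fun (\<lambda>x. H (\<chi> j. P j x))" by (rule polynomial_fun_comp[OF H(1)]) (simp add: P)
    fix x assume x: "x \<in> X"
    have "(\<chi> j. P j x) = \<pi> x" by (simp add: vec_eq_iff P(2)[OF x])
    moreover have "\<pi> x \<in> B" using assms(3) x by (auto simp: regular_map_def)
    ultimately show "pullback X \<pi> h x = H (\<chi> j. P j x)" using x H(2) by (simp add: pullback_def restr_def)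
  qed (simp add: pullback_def)
qed

text \<open>The translation coordinate grows at unit speed but may have poles along \<alpha> = 0.
  Multiplying it by a power of \<alpha>, which is constant along the flow, removes them.\<close>

lemma slice_function:
  assumes B: "algebraic_set B" and \<alpha>: "\<alpha> \<in> field_kernel B D"
    and slice: "admits_slice B D {b\<in>B. \<alpha> b \<noteq> 0} R"
  shows "\<exists>a\<in>regular_funs B. \<exists>N. \<forall>b\<in>B. \<alpha> b \<noteq> 0 \<longrightarrow> D a b = \<alpha> b ^ N"
proof -
  let ?U = "{b\<in>B. \<alpha> b \<noteq> 0}"
  obtain \<psi> \<Phi> where \<psi>: "alg_isomorphism ?U (direct_product R affine_line) \<psi>"
    and \<Phi>: "algebraic_action ?U \<Phi>" "generates B D ?U \<Phi>"
    and transl: "\<And>t b. b \<in> ?U \<Longrightarrow> \<psi> (\<Phi> t b) = join (proj1 (\<psi> b)) (proj2 (\<psi> b) + vec t)"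
    using slice unfolding admits_slice_def by blast
  have add: "additive_action ?U \<Phi>" using \<Phi>(1) by (simp add: algebraic_action_def)
  have \<alpha>': "\<alpha> \<in> regular_funs B" "D \<alpha> = (\<lambda>_. 0)" using \<alpha> by (auto simp: field_kernel_def)
  obtain A where A: "polynomial_fun A" "\<alpha> = restr B A" using regular_funsE[OF B \<alpha>'(1)] .
  have U: "?U = {b\<in>B. A b \<noteq> 0}" by (auto simp: A(2) restr_def)
  have "regular_on {b\<in>B. A b \<noteq> 0} (\<lambda>b. \<psi> b $ Inr 1)"
    using \<psi> unfolding U alg_isomorphism_def regular_map_def by blast
  from regular_on_fraction[OF B A(1) this] obtain N P where P: "polynomial_fun P"
      "\<And>b. b \<in> B \<Longrightarrow> A b \<noteq> 0 \<Longrightarrow> A b ^ N * \<psi> b $ Inr 1 = P b"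
    by blast
  let ?a = "restr B P"
  have a: "?a \<in> regular_funs B" by (rule restr_regular[OF P(1)])
  have a_eq: "?a b = \<alpha> b ^ N * \<psi> b $ Inr 1" if "b \<in> ?U" for b
    using that P(2)[of b] by (auto simp: A(2) restr_def)
  have "D ?a b = \<alpha> b ^ N" if b: "b \<in> ?U" for b
  proof -
    have "?a (\<Phi> t b) = \<alpha> b ^ N * (\<psi> b $ Inr 1 + t)" for t
      using a_eq[OF additive_actionD(1)[OF add b, of t]] transl[OF b, of t]
        flow_invariant[OF add \<Phi>(2) \<alpha>'(1) b, of t] \<alpha>'(2)
      by (simp add: proj2_def)
    moreover have "((\<lambda>t. ?a (\<Phi> t b)) has_field_derivative D ?a b) (at 0)"
      using \<Phi>(2) a b unfolding generates_def by blast
    ultimately have "((\<lambda>t. \<alpha> b ^ N * (\<psi> b $ Inr 1 + t)) has_field_derivative D ?a b) (at 0)" by simp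
    moreover have "((\<lambda>t. \<alpha> b ^ N * (\<psi> b $ Inr 1 + t)) has_field_derivative \<alpha> b ^ N) (at 0)"
      by (auto intro!: derivative_eq_intros)
    ultimately show ?thesis by (rule DERIV_unique)
  qed
  then show ?thesis using a by blast
qed

text \<open>Invariance of the image of the pullback ensures that \<open>inv_into\<close> picks an
  actual preimage.\<close>

lemma induced_field_pullback:
  assumes "\<xi> ` pullback X \<pi> ` regular_funs B \<subseteq> pullback X \<pi> ` regular_funs B" "f \<in> regular_funs B"
  shows "induced_field X B \<pi> \<xi> f \<in> regular_funs B"
    "\<xi> (pullback X \<pi> f) = pullback X \<pi> (induced_field X B \<pi> \<xi> f)"
proof -
  have "\<xi> (pullback X \<pi> f) \<in> pullback X \<pi> ` regular_funs B" using assms by blast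
  from inv_into_into[OF this] f_inv_into_f[OF this]
  show "induced_field X B \<pi> \<xi> f \<in> regular_funs B"
    "\<xi> (pullback X \<pi> f) = pullback X \<pi> (induced_field X B \<pi> \<xi> f)"
    using assms(2) by (simp_all add: induced_field_def)
qed


section \<open>A vertical field\<close>

text \<open>Records poles of bounded order along \<open>h = 0\<close>. The class is stable under
  substitution into polynomials, so such poles can be followed through compositions.\<close>

definition fractional_on ::
  "(complex ^ 'n) set \<Rightarrow> (complex ^ 'n \<Rightarrow> complex) \<Rightarrow> (complex ^ 'n \<Rightarrow> complex) \<Rightarrow> bool" where
  "fractional_on S h f \<longleftrightarrow> (\<exists>n P. polynomial_fun P \<and> (\<forall>z\<in>S. h z ^ n * f z = P z))"

lemma fractional_on_polynomial: "polynomial_fun p \<Longrightarrow> fractional_on S h p"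
  unfolding fractional_on_def by (intro exI[of _ 0] exI[of _ p]) auto

lemma fractional_on_add:
  assumes "polynomial_fun h" "fractional_on S h f" "fractional_on S h g"
  shows "fractional_on S h (\<lambda>z. f z + g z)"
proof -
  obtain n m P Q where P: "polynomial_fun P" "\<And>z. z \<in> S \<Longrightarrow> h z ^ n * f z = P z"
    and Q: "polynomial_fun Q" "\<And>z. z \<in> S \<Longrightarrow> h z ^ m * g z = Q z"
    using assms(2,3) unfolding fractional_on_def by blast
  have "h z ^ (n + m) * (f z + g z) = h z ^ m * P z + h z ^ n * Q z" if "z \<in> S" for z
    by (simp add: P(2)[OF that, symmetric] Q(2)[OF that, symmetric] power_add algebra_simps)
  moreover have "polynomial_fun (\<lambda>z. h z ^ m * P z + h z ^ n * Q z)"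
    by (intro polynomial_fun.add polynomial_fun.mult polynomial_fun_power assms(1) P(1) Q(1))
  ultimately show ?thesis unfolding fractional_on_def by blast
qed

lemma fractional_on_mult:
  assumes "fractional_on S h f" "fractional_on S h g"
  shows "fractional_on S h (\<lambda>z. f z * g z)"
proof -
  obtain n m P Q where P: "polynomial_fun P" "\<And>z. z \<in> S \<Longrightarrow> h z ^ n * f z = P z"
    and Q: "polynomial_fun Q" "\<And>z. z \<in> S \<Longrightarrow> h z ^ m * g z = Q z"
    using assms unfolding fractional_on_def by blast
  have "h z ^ (n + m) * (f z * g z) = P z * Q z" if "z \<in> S" for z
    by (simp add: P(2)[OF that, symmetric] Q(2)[OF that, symmetric] power_add)
  then show ?thesis using polynomial_fun.mult[OF P(1) Q(1)] unfolding fractional_on_def by blast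
qed

lemma fractional_on_comp:
  assumes "polynomial_fun p" "polynomial_fun h" "\<And>j. fractional_on S h (\<lambda>z. G z $ j)"
  shows "fractional_on S h (\<lambda>z. p (G z))"
  using assms(1)
  by induction (auto intro: fractional_on_polynomial polynomial_fun.const assms(3)
      fractional_on_add[OF assms(2)] fractional_on_mult)

lemma fractional_on_join:
  assumes "polynomial_fun p" "polynomial_fun h" "\<And>i. fractional_on S h (\<lambda>z. F z $ i)"
    "\<And>j. fractional_on S h (\<lambda>z. G z $ j)"
  shows "fractional_on S h (\<lambda>z. p (join (F z) (G z)))"
proof (rule fractional_on_comp[OF assms(1,2)])
  fix j show "fractional_on S h (\<lambda>z. join (F z) (G z) $ j)"
    using assms(3,4) by (cases j) auto
qed

lemma fractional_on_cancel:
  assumes "fractional_on S h g" "\<And>z. z \<in> S \<Longrightarrow> g z = h z ^ m * f z"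
  shows "fractional_on S h f"
proof -
  obtain n P where P: "polynomial_fun P" "\<forall>z\<in>S. h z ^ n * g z = P z"
    using assms(1) unfolding fractional_on_def by blast
  then have "\<forall>z\<in>S. h z ^ (n + m) * f z = P z" by (simp add: assms(2) power_add mult.assoc)
  then show ?thesis using P(1) unfolding fractional_on_def by blast
qed

text \<open>Over the open set the flow \<open>\<Theta>\<close> of \<open>\<delta>\<close> acts on the fibres. It is a polynomial in the time with
  coefficients that have poles along \<open>\<alpha> = 0\<close>; running it at speed \<open>\<alpha>\<^sup>N\<close> cancels the poles of all
  coefficients except the constant one, which is the identity.\<close>

lemma vertical_field:
  fixes X :: "(complex ^ 'n::finite) set" and B :: "(complex ^ 'm::finite) set"
    and Y :: "(complex ^ 'p::finite) set"
  assumes X: "algebraic_set X" and B: "algebraic_set B" and Y: "algebraic_set Y"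
    and \<pi>: "regular_map X B \<pi>" and \<alpha>: "\<alpha> \<in> regular_funs B"
    and triv: "trivial_over X \<pi> {b\<in>B. \<alpha> b \<noteq> 0} Y" and b0: "b0 \<in> B" "\<alpha> b0 \<noteq> 0"
    and \<delta>: "locally_nilpotent_field Y \<delta>" "\<delta> \<noteq> zero_field"
  shows "\<exists>\<eta>. locally_nilpotent_field X \<eta> \<and> \<eta> \<noteq> zero_field \<and>
    (\<forall>h\<in>regular_funs B. \<eta> (pullback X \<pi> h) = (\<lambda>_. 0))"
proof -
  let ?B = "{b\<in>B. \<alpha> b \<noteq> 0}"
  define V where "V = {x\<in>X. \<pi> x \<in> ?B}"
  obtain A where A: "polynomial_fun A" "\<alpha> = restr B A" using regular_funsE[OF B \<alpha>] .
  have "\<forall>j. \<exists>P. polynomial_fun P \<and> (\<forall>x\<in>X. \<pi> x $ j = P x)"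
    using \<pi> unfolding regular_map_def by (intro allI regular_on_polynomial[OF X]) blast
  then obtain p where p: "\<And>j. polynomial_fun (p j)" "\<And>j x. x \<in> X \<Longrightarrow> \<pi> x $ j = p j x" by metis
  have \<pi>B: "\<pi> x \<in> B" if "x \<in> X" for x using \<pi> that by (auto simp: regular_map_def)
  \<comment> \<open>A polynomial on the ambient space that extends the pullback of \<alpha> from
    \<open>X\<close>.\<close>
  define U where "U x = A (\<chi> j. p j x)" for x
  have U: "polynomial_fun U" unfolding U_def by (rule polynomial_fun_comp[OF A(1)]) (simp add: p(1))
  have U_eq: "U x = A (\<pi> x)" if "x \<in> X" for x
  proof -
    have "(\<chi> j. p j x) = \<pi> x" by (simp add: vec_eq_iff p(2)[OF that])
    then show ?thesis by (simp add: U_def)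
  qed
  have V_eq: "V = {x\<in>X. U x \<noteq> 0}" using \<pi>B by (auto simp: V_def U_eq A(2) restr_def)
  have VX: "V \<subseteq> X" by (auto simp: V_def)
  obtain \<phi> where "alg_isomorphism V (direct_product ?B Y) \<phi>"
    and "\<forall>x\<in>X. \<pi> x \<in> ?B \<longrightarrow> proj1 (\<phi> x) = \<pi> x"
    using triv unfolding trivial_over_def V_def by blast
  then obtain \<psi> where \<phi>: "regular_map V (direct_product ?B Y) \<phi>"
    and \<psi>: "regular_map (direct_product ?B Y) V \<psi>"
    and \<psi>\<phi>: "\<And>x. x \<in> V \<Longrightarrow> \<psi> (\<phi> x) = x" and \<phi>\<psi>: "\<And>z. z \<in> direct_product ?B Y \<Longrightarrow> \<phi> (\<psi> z) = z"
    and proj1_\<phi>: "\<And>x. x \<in> V \<Longrightarrow> proj1 (\<phi> x) = \<pi> x"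
    unfolding alg_isomorphism_def V_def by blast
  have \<psi>V: "\<psi> z \<in> V" if "z \<in> direct_product ?B Y" for z
    using \<psi> that by (auto simp: regular_map_def)
  have \<phi>Y: "proj2 (\<phi> x) \<in> Y" if "x \<in> V" for x
    using \<phi> that by (auto simp: regular_map_def mem_direct_product)
  obtain \<Psi> where \<Psi>: "algebraic_action Y \<Psi>" "generates Y \<delta> Y \<Psi>" and v\<delta>: "alg_vector_field Y \<delta>"
    using \<delta>(1) unfolding locally_nilpotent_field_def by blast
  have "additive_action Y \<Psi>" using \<Psi>(1) by (simp add: algebraic_action_def)
  note \<Psi>D = additive_actionD[OF this]

  define \<Theta> where "\<Theta> s x = \<psi> (join (\<pi> x) (\<Psi> s (proj2 (\<phi> x))))" for s x
  have mem: "join (\<pi> x) (\<Psi> s (proj2 (\<phi> x))) \<in> direct_product ?B Y" if "x \<in> V" for s x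
    using that \<Psi>D(1)[OF \<phi>Y[OF that]] by (simp add: V_def)
  have \<Theta>V: "\<Theta> s x \<in> V" if "x \<in> V" for s x unfolding \<Theta>_def by (rule \<psi>V[OF mem[OF that]])
  have \<phi>\<Theta>: "\<phi> (\<Theta> s x) = join (\<pi> x) (\<Psi> s (proj2 (\<phi> x)))" if "x \<in> V" for s x
    unfolding \<Theta>_def by (rule \<phi>\<psi>[OF mem[OF that]])
  have \<pi>\<Theta>: "\<pi> (\<Theta> s x) = \<pi> x" if "x \<in> V" for s x
    using proj1_\<phi>[OF \<Theta>V[OF that]] \<phi>\<Theta>[OF that] by simp
  have U\<Theta>: "U (\<Theta> s x) = U x" if "x \<in> V" for s x
    using \<Theta>V[OF that, of s] that VX by (simp add: U_eq \<pi>\<Theta> subset_iff)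
  have \<Theta>0: "\<Theta> 0 x = x" if "x \<in> V" for x
    using \<psi>\<phi>[OF that] join_proj[of "\<phi> x"] proj1_\<phi>[OF that] \<Psi>D(2)[OF \<phi>Y[OF that]] by (simp add: \<Theta>_def)
  have \<Theta>_add: "\<Theta> (s + t) x = \<Theta> s (\<Theta> t x)" if "x \<in> V" for s t x
    using \<pi>\<Theta>[OF that] \<phi>\<Theta>[OF that] \<Psi>D(3)[OF \<phi>Y[OF that]] by (simp add: \<Theta>_def)

  let ?S = "direct_product affine_line V"
  let ?h = "\<lambda>z :: complex ^ (1 + 'n). U (proj2 z)"
  have h: "polynomial_fun ?h" by (rule polynomial_fun_proj2[OF U])
  \<comment> \<open>The trivialisation and its inverse are regular only where \<alpha> is nonzero;
    composing them with the polynomial flow \<open>\<Psi>\<close> leaves powers of \<open>U\<close>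
    as denominators.\<close>
  have "fractional_on ?S ?h (\<lambda>z. \<Theta> (z $ Inl 1) (proj2 z) $ j)" for j
  proof -
    have f\<pi>: "fractional_on ?S ?h (\<lambda>z. \<pi> (proj2 z) $ i)" for i
    proof -
      have "\<forall>z\<in>?S. ?h z ^ 0 * \<pi> (proj2 z) $ i = p i (proj2 z)"
        using VX by (auto simp: mem_direct_product p(2))
      then show ?thesis unfolding fractional_on_def using polynomial_fun_proj2[OF p(1)] by blast
    qed
    have f\<phi>: "fractional_on ?S ?h (\<lambda>z. proj2 (\<phi> (proj2 z)) $ l)" for l
    proof -
      have "regular_on {x\<in>X. U x \<noteq> 0} (\<lambda>x. \<phi> x $ Inr l)"
        using \<phi> unfolding V_eq regular_map_def by blast
      from regular_on_fraction[OF X U this] obtain n P where P: "polynomial_fun P"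
        "\<And>x. x \<in> X \<Longrightarrow> U x \<noteq> 0 \<Longrightarrow> U x ^ n * \<phi> x $ Inr l = P x" by blast
      then have "\<forall>z\<in>?S. ?h z ^ n * proj2 (\<phi> (proj2 z)) $ l = P (proj2 z)"
        by (auto simp: mem_direct_product V_eq proj2_def[of "\<phi> _"])
      then show ?thesis unfolding fractional_on_def using polynomial_fun_proj2[OF P(1)] by blast
    qed
    obtain P\<Psi> :: "'p \<Rightarrow> complex ^ (1 + 'p) \<Rightarrow> complex" where P\<Psi>: "\<And>j. polynomial_fun (P\<Psi> j)"
        "\<And>t x j. x \<in> Y \<Longrightarrow> \<Psi> t x $ j = P\<Psi> j (join (vec t) x)"
      using algebraic_action_polynomial[OF Y \<Psi>(1)] by blast
    let ?\<Psi> = "\<lambda>z :: complex ^ (1 + 'n). \<chi> l. P\<Psi> l (join (vec (z $ Inl 1)) (proj2 (\<phi> (proj2 z))))"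
    have \<Psi>_eq: "?\<Psi> z = \<Psi> (z $ Inl 1) (proj2 (\<phi> (proj2 z)))" if "z \<in> ?S" for z
      using that \<phi>Y by (simp add: vec_eq_iff mem_direct_product P\<Psi>(2))
    have f\<Psi>: "fractional_on ?S ?h (\<lambda>z. ?\<Psi> z $ l)" for l
    proof -
      have "fractional_on ?S ?h (\<lambda>z. (vec (z $ Inl 1) :: complex ^ 1) $ i)" for i
        by (simp add: fractional_on_polynomial polynomial_fun.coord)
      then have "fractional_on ?S ?h (\<lambda>z. P\<Psi> l (join (vec (z $ Inl 1)) (proj2 (\<phi> (proj2 z)))))"
        by (intro fractional_on_join[OF P\<Psi>(1) h] f\<phi>)
      then show ?thesis by simp
    qed
    have prod_eq: "direct_product ?B Y = {z \<in> direct_product B Y. A (proj1 z) \<noteq> 0}"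
      by (auto simp: mem_direct_product A(2) restr_def)
    have "regular_on (direct_product ?B Y) (\<lambda>z. \<psi> z $ j)"
      using \<psi> unfolding regular_map_def by blast
    then have "regular_on {z \<in> direct_product B Y. A (proj1 z) \<noteq> 0} (\<lambda>z. \<psi> z $ j)"
      unfolding prod_eq .
    from regular_on_fraction[OF algebraic_set_direct_product[OF B Y] polynomial_fun_proj1[OF A(1)] this]
    obtain m P where P: "polynomial_fun P" "\<And>z. z \<in> direct_product B Y \<Longrightarrow> A (proj1 z) \<noteq> 0 \<Longrightarrow>
        A (proj1 z) ^ m * \<psi> z $ j = P z" by blast
    show ?thesis
    proof (rule fractional_on_cancel)
      show "fractional_on ?S ?h (\<lambda>z. P (join (\<pi> (proj2 z)) (?\<Psi> z)))"
        by (rule fractional_on_join[OF P(1) h f\<pi> f\<Psi>])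
      fix z assume z: "z \<in> ?S"
      then have x: "proj2 z \<in> V" by (simp add: mem_direct_product)
      have "P (join (\<pi> (proj2 z)) (?\<Psi> z)) =
          A (\<pi> (proj2 z)) ^ m * \<psi> (join (\<pi> (proj2 z)) (?\<Psi> z)) $ j"
        using P(2)[of "join (\<pi> (proj2 z)) (?\<Psi> z)"] mem[OF x, of "z $ Inl 1"]
        unfolding \<Psi>_eq[OF z] by (auto simp: A(2) restr_def)
      \<comment> \<open>The denominator of \<open>\<psi>\<close> is a power of \<open>A\<close> at
        the base point, that is, the same power of \<open>U\<close>.\<close>
      then show "P (join (\<pi> (proj2 z)) (?\<Psi> z)) = ?h z ^ m * \<Theta> (z $ Inl 1) (proj2 z) $ j"
        unfolding \<Psi>_eq[OF z] using x VX by (simp add: \<Theta>_def U_eq subset_iff)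
    qed
  qed
  then have "\<forall>j. \<exists>n P. polynomial_fun P \<and>
      (\<forall>z\<in>?S. ?h z ^ n * \<Theta> (z $ Inl 1) (proj2 z) $ j = P z)"
    unfolding fractional_on_def by blast
  then obtain K F where F: "\<And>j. polynomial_fun (F j)"
      "\<And>j z. z \<in> ?S \<Longrightarrow> ?h z ^ K j * \<Theta> (z $ Inl 1) (proj2 z) $ j = F j z" by metis
  have "\<forall>j. \<exists>Q d. (\<forall>m. polynomial_fun (\<lambda>x. coeff (Q x) m)) \<and> (\<forall>x. degree (Q x) \<le> d) \<and>
      (\<forall>s x. F j (join (vec s) x) = poly (Q x) s)"
    using polynomial_fun_expand[OF F(1)] by blast
  then obtain Q d where Q: "\<And>j m. polynomial_fun (\<lambda>x. coeff (Q j x) m)" "\<And>j x. degree (Q j x) \<le> d j"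
      "\<And>j s x. F j (join (vec s) x) = poly (Q j x) s" by metis
  have \<Theta>_poly: "U x ^ K j * \<Theta> s x $ j = poly (Q j x) s" if "x \<in> V" for j s x
    using F(2)[of "join (vec s) x" j] that by (simp add: Q(3))
  \<comment> \<open>\<open>N\<close> exceeds every pole order \<open>K j\<close>, so for positive
    \<open>m\<close> the factor \<open>U ^ (N * m)\<close> cancels the pole and leaves a positive
    power of \<open>U\<close>.\<close>
  define N where "N = Suc (\<Sum>j\<in>UNIV. K j)"
  have NK: "K j < N * m" if "m \<ge> 1" for j m
  proof -
    have "K j \<le> (\<Sum>j\<in>UNIV. K j)" by (rule member_le_sum) auto
    also have "\<dots> < N * 1" by (simp add: N_def)
    also have "\<dots> \<le> N * m" using that by (intro mult_le_mono2)
    finally show ?thesis .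
  qed
  \<comment> \<open>\<open>U\<close> is constant along \<open>\<Theta>\<close>, so the group law
    survives the change of speed. Points outside \<open>V\<close> are fixed, in accordance with the
    positive powers of \<open>U\<close> in \<open>P\<close> below.\<close>
  define \<Phi> where "\<Phi> t x = (if x \<in> V then \<Theta> (U x ^ N * t) x else x)" for t x
  have \<Phi>_add: "additive_action X \<Phi>" unfolding additive_action_def
    using \<Theta>V VX by (auto simp: \<Phi>_def \<Theta>0 U\<Theta> distrib_left \<Theta>_add)
  define P where "P j z = proj2 z $ j +
    (\<Sum>m=1..d j. (z $ Inl 1) ^ m * U (proj2 z) ^ (N * m - K j) * coeff (Q j (proj2 z)) m)"
    for j and z :: "complex ^ (1 + 'n)"
  have "polynomial_fun (P j)" for j unfolding P_def
    by (intro polynomial_fun.add polynomial_fun_sum polynomial_fun.mult polynomial_fun_power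
        polynomial_fun.coord h polynomial_fun_proj2[OF Q(1)] polynomial_fun_proj2[OF polynomial_fun.coord])
  moreover have "\<Phi> t x $ j = P j (join (vec t) x)" if x: "x \<in> X" for t x j
  proof (cases "x \<in> V")
    case True
    then have nz: "U x \<noteq> 0" by (simp add: V_eq)
    have split: "{..d j} = insert 0 {1..d j}" by auto
    have "U x ^ K j * \<Phi> t x $ j = poly (Q j x) (U x ^ N * t)" using True by (simp add: \<Phi>_def \<Theta>_poly)
    also have "\<dots> = coeff (Q j x) 0 + (\<Sum>m=1..d j. coeff (Q j x) m * (U x ^ N * t) ^ m)"
      unfolding poly_eq_sum_atMost[OF Q(2)] split by simp
    also have "coeff (Q j x) 0 = U x ^ K j * x $ j"
      using \<Theta>_poly[OF True, of j 0] by (simp add: \<Theta>0[OF True] poly_0_coeff_0)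
    also have "(\<Sum>m=1..d j. coeff (Q j x) m * (U x ^ N * t) ^ m) =
        (\<Sum>m=1..d j. U x ^ K j * (t ^ m * U x ^ (N * m - K j) * coeff (Q j x) m))"
    proof (rule sum.cong[OF refl])
      fix m assume "m \<in> {1..d j}"
      then have "N * m = K j + (N * m - K j)" using NK[of m j] by simp
      then have "U x ^ (N * m) = U x ^ K j * U x ^ (N * m - K j)" by (metis power_add)
      then show "coeff (Q j x) m * (U x ^ N * t) ^ m =
          U x ^ K j * (t ^ m * U x ^ (N * m - K j) * coeff (Q j x) m)"
        by (simp add: power_mult_distrib flip: power_mult)
    qed
    also have "U x ^ K j * x $ j + \<dots> = U x ^ K j * P j (join (vec t) x)"
      by (simp add: P_def sum_distrib_left distrib_left)
    finally show ?thesis using nz by simp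
  next
    case False
    then have "U x = 0" using x by (simp add: V_eq)
    then have "(\<Sum>m=1..d j. t ^ m * U x ^ (N * m - K j) * coeff (Q j x) m) = 0"
      using NK[of _ j] by (intro sum.neutral) auto
    then show ?thesis using False by (simp add: P_def \<Phi>_def)
  qed
  ultimately have \<Phi>: "algebraic_action X \<Phi>" by (rule algebraic_actionI[OF \<Phi>_add])

  let ?\<eta> = "action_field X \<Phi>"
  note \<eta> = locally_nilpotent_action_field[OF X \<Phi>]
  have v\<eta>: "alg_vector_field X ?\<eta>" using \<eta>(1) by (simp add: locally_nilpotent_field_def)
  have "?\<eta> (pullback X \<pi> g) = (\<lambda>_. 0)" if "g \<in> regular_funs B" for g
  proof (rule field_zeroI[OF v\<eta> \<eta>(2) pullback_regular[OF X B \<pi> that]])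
    fix t x assume "x \<in> X"
    then show "pullback X \<pi> g (\<Phi> t x) = pullback X \<pi> g x"
      using additive_actionD(1)[OF \<Phi>_add, of x t] by (simp add: pullback_def) (simp add: \<Phi>_def \<pi>\<Theta>)
  qed
  \<comment> \<open>A zero field would make all coordinates invariant, hence \<open>\<Phi>\<close>
    trivial. On the fibre over \<open>b0\<close> this would make \<open>\<Psi>\<close> trivial and
    \<delta> zero.\<close>
  moreover have "?\<eta> \<noteq> zero_field"
  proof
    assume z: "?\<eta> = zero_field"
    have \<Phi>_id: "\<Phi> t x = x" if x: "x \<in> X" for t x
    proof -
      have "restr X (\<lambda>x. x $ j) (\<Phi> t x) = restr X (\<lambda>x. x $ j) x" for j
        by (rule flow_invariant[OF \<Phi>_add \<eta>(2) restr_regular[OF polynomial_fun.coord] x])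
          (simp add: z zero_field_def)
      then show ?thesis using additive_actionD(1)[OF \<Phi>_add x] x by (simp add: restr_def vec_eq_iff)
    qed
    have "\<Psi> s y = y" if y: "y \<in> Y" for s y
    proof -
      let ?x = "\<psi> (join b0 y)"
      have m: "join b0 y \<in> direct_product ?B Y" using y b0 by simp
      have x: "?x \<in> V" by (rule \<psi>V[OF m])
      then have "U ?x \<noteq> 0" by (simp add: V_eq)
      \<comment> \<open>The speed is nonzero over \<open>b0\<close>, so dividing by it recovers the
        original time \<open>s\<close>.\<close>
      then have "\<Theta> s ?x = ?x" using \<Phi>_id[of ?x "s / U ?x ^ N"] x VX by (auto simp: \<Phi>_def)
      then show ?thesis using \<phi>\<Theta>[OF x, of s] \<phi>\<psi>[OF m] by (metis proj_join(2))
    qed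
    then have "\<delta> g = (\<lambda>_. 0)" if "g \<in> regular_funs Y" for g
      by (intro field_zeroI[OF v\<delta> \<Psi>(2) that]) simp
    then have "\<delta> = zero_field" using alg_vector_fieldD(1)[OF v\<delta>] by (auto simp: zero_field_def fun_eq_iff)
    then show False using \<delta>(2) by contradiction
  qed
  ultimately show ?thesis using \<eta>(1) by blast
qed


section \<open>Gluing over the cover of the base\<close>

theorem corollary8p2:
  fixes X :: "(complex ^ 'n) set" and B :: "(complex ^ 'm) set" and Y :: "(complex ^ 'p) set"
    and \<pi> :: "complex ^ 'n \<Rightarrow> complex ^ 'm"
    and \<delta> :: "'p field_op"
    and k :: nat
    and \<alpha> :: "nat \<Rightarrow> complex ^ 'm \<Rightarrow> complex"
    and \<xi> :: "nat \<Rightarrow> 'n field_op"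
    and R :: "nat \<Rightarrow> (complex ^ 'r) set"
  assumes smooth: "smooth_affine_variety X" and "smooth_affine_variety B" and "affine_variety Y"
    and fibration: "zariski_locally_trivial X B \<pi> Y"
    and "locally_nilpotent_field Y \<delta>" and "\<delta> \<noteq> zero_field"
    and "\<And>i. i \<in> {1..k} \<Longrightarrow> \<alpha> i \<in> regular_funs B"
    and "\<And>b. b \<in> B \<Longrightarrow> \<exists>i\<in>{1..k}. \<alpha> i b \<noteq> 0"
    and "\<And>i. i \<in> {1..k} \<Longrightarrow> trivial_over X \<pi> {b\<in>B. \<alpha> i b \<noteq> 0} Y"
    and "\<And>i. i \<in> {1..k} \<Longrightarrow> locally_nilpotent_field X (\<xi> i)"
    and i: "\<And>i. i \<in> {1..k} \<Longrightarrow>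
      \<xi> i ` pullback X \<pi> ` regular_funs B \<subseteq> pullback X \<pi> ` regular_funs B"
    and ii: "\<And>i. i \<in> {1..k} \<Longrightarrow> \<alpha> i \<in> field_kernel B (induced_field X B \<pi> (\<xi> i))"
    and "\<And>i. i \<in> {1..k} \<Longrightarrow> affine_variety (R i)"
    and iii: "\<And>i. i \<in> {1..k} \<Longrightarrow>
      admits_slice B (induced_field X B \<pi> (\<xi> i)) {b\<in>B. \<alpha> i b \<noteq> 0} (R i)"
  shows "\<exists>\<eta> J. locally_nilpotent_field X \<eta> \<and> \<eta> \<noteq> zero_field \<and>
    ideal J (coord_ring X) \<and> J \<noteq> {\<zero>\<^bsub>coord_ring X\<^esub>} \<and>
    (\<forall>f\<in>J. (\<lambda>g x. f x * \<eta> g x) \<in> Lie_alg X)"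
proof -
  note \<delta> = assms(5,6) and \<alpha> = assms(7) and cover = assms(8) and triv = assms(9) and \<xi> = assms(10)
  have X: "algebraic_set X" and B: "algebraic_set B" and Y: "algebraic_set Y"
    and neX: "X \<noteq> {}" and neB: "B \<noteq> {}"
    using assms(1-3) unfolding smooth_affine_variety_def affine_variety_def zariski_irreducible_def
    by (auto intro: algebraic_set_closedin)
  have \<pi>: "regular_map X B \<pi>" using fibration by (simp add: zariski_locally_trivial_def)
  obtain b0 i0 where b0: "b0 \<in> B" "i0 \<in> {1..k}" "\<alpha> i0 b0 \<noteq> 0" using neB cover by blast
  obtain \<eta> where \<eta>: "locally_nilpotent_field X \<eta>" "\<eta> \<noteq> zero_field"
    and \<eta>B: "\<And>h. h \<in> regular_funs B \<Longrightarrow> \<eta> (pullback X \<pi> h) = (\<lambda>_. 0)"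
    using vertical_field[OF X B Y \<pi> \<alpha>[OF b0(2)] triv[OF b0(2)] b0(1,3) \<delta>] by blast
  note pr = pullback_regular[OF X B \<pi>]
  have v\<eta>: "alg_vector_field X \<eta>" using \<eta>(1) by (simp add: locally_nilpotent_field_def)
  have \<pi>B: "\<pi> x \<in> B" if "x \<in> X" for x using \<pi> that by (auto simp: regular_map_def)

  \<comment> \<open>The exponent depends on \<open>i\<close> and \<open>f\<close> but serves every
    \<open>h\<close> killed by \<eta>, so the partition of unity can be chosen after it.\<close>
  have local: "\<exists>n. \<forall>h\<in>regular_funs X. \<eta> h = (\<lambda>_. 0) \<longrightarrow>
      (\<lambda>g x. h x * pullback X \<pi> (\<alpha> i) x ^ n * f x * \<eta> g x) \<in> Lie_alg X"
    if i: "i \<in> {1..k}" and f: "f \<in> regular_funs X" for i f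
  proof -
    let ?u = "pullback X \<pi> (\<alpha> i)" and ?D = "induced_field X B \<pi> (\<xi> i)"
    note ind = induced_field_pullback[OF assms(11)[OF i]]
    have v\<xi>: "alg_vector_field X (\<xi> i)" using \<xi>[OF i] by (simp add: locally_nilpotent_field_def)
    have u: "?u \<in> regular_funs X" by (rule pr[OF \<alpha>[OF i]])
    have \<xi>u: "\<xi> i ?u = (\<lambda>_. 0)"
      using ind(2)[OF \<alpha>[OF i]] ii[OF i] by (auto simp: field_kernel_def pullback_def)
    obtain a N where a: "a \<in> regular_funs B" "\<And>b. b \<in> B \<Longrightarrow> \<alpha> i b \<noteq> 0 \<Longrightarrow> ?D a b = \<alpha> i b ^ N"
      using slice_function[OF B ii[OF i] iii[OF i]] by blast
    \<comment> \<open>The formula for \<open>?D a\<close> is known only where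
      \<open>\<alpha> i\<close> is nonzero. The extra factor \<open>?u\<close> makes both sides
      vanish elsewhere, at the price of the exponent \<open>Suc N\<close>.\<close>
    let ?a = "\<lambda>x. ?u x * pullback X \<pi> a x"
    have \<xi>a: "\<xi> i ?a = restr X (\<lambda>x. ?u x ^ Suc N)"
    proof
      fix x
      have "\<xi> i ?a x = ?u x * pullback X \<pi> (?D a) x"
        by (simp add: alg_vector_fieldD(5)[OF v\<xi> u pr[OF a(1)]] \<xi>u ind(2)[OF a(1)])
      then show "\<xi> i ?a x = restr X (\<lambda>x. ?u x ^ Suc N) x"
        using a(2)[OF \<pi>B, of x] by (cases "\<alpha> i (\<pi> x) = 0") (auto simp: pullback_def restr_def)
    qed
    have "\<eta> ?a = (\<lambda>_. 0)"
      by (rule kernel_mult[OF v\<eta> u pr[OF a(1)] \<eta>B[OF \<alpha>[OF i]] \<eta>B[OF a(1)]])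
    then show ?thesis
      by (intro slice_multiples_in_Lie_alg[OF X \<xi>[OF i] \<eta>(1) u regular_funs_mult[OF X u pr[OF a(1)]]
            \<xi>u \<xi>a \<eta>B[OF \<alpha>[OF i]] _ f])
  qed

  have "(\<lambda>g x. f x * \<eta> g x) \<in> Lie_alg X" if f: "f \<in> regular_funs X" for f
  proof -
    have "\<forall>i\<in>{1..k}. \<exists>n. \<forall>h\<in>regular_funs X. \<eta> h = (\<lambda>_. 0) \<longrightarrow>
        (\<lambda>g x. h x * pullback X \<pi> (\<alpha> i) x ^ n * f x * \<eta> g x) \<in> Lie_alg X"
      using local[OF _ f] by blast
    from bchoice[OF this] obtain n where n: "(\<lambda>g x. h x * pullback X \<pi> (\<alpha> i) x ^ n i * f x * \<eta> g x) \<in> Lie_alg X"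
      if "i \<in> {1..k}" "h \<in> regular_funs X" "\<eta> h = (\<lambda>_. 0)" for i h by blast
    \<comment> \<open>The coefficients come from the base, so their pullbacks are killed by \<eta>
      and qualify as the \<open>h\<close> in \<open>n\<close>.\<close>
    obtain h where h: "\<And>i. h i \<in> regular_funs B"
        "\<And>b. b \<in> B \<Longrightarrow> (\<Sum>i\<in>{1..k}. h i b * \<alpha> i b ^ n i) = 1"
      using partition_of_unity[OF B finite_atLeastAtMost \<alpha> cover, where n = n] by metis
    have "(\<lambda>g x. \<Sum>i\<in>{1..k}. pullback X \<pi> (h i) x * pullback X \<pi> (\<alpha> i) x ^ n i * f x * \<eta> g x) \<in> Lie_alg X"
      by (rule Lie_alg_sum[OF locally_nilpotent_in_Lie_alg[OF X \<eta>(1)] n[OF _ pr[OF h(1)] \<eta>B[OF h(1)]]])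
    moreover have "(\<Sum>i\<in>{1..k}. pullback X \<pi> (h i) x * pullback X \<pi> (\<alpha> i) x ^ n i * f x * \<eta> g x) =
        f x * \<eta> g x" for g x
    proof (cases "x \<in> X")
      case True
      then have "(\<Sum>i\<in>{1..k}. pullback X \<pi> (h i) x * pullback X \<pi> (\<alpha> i) x ^ n i * f x * \<eta> g x) =
          (\<Sum>i\<in>{1..k}. h i (\<pi> x) * \<alpha> i (\<pi> x) ^ n i) * (f x * \<eta> g x)"
        by (simp add: pullback_def sum_distrib_right mult.assoc)
      then show ?thesis by (simp only: h(2)[OF \<pi>B[OF True]] mult_1)
    next
      case False
      then show ?thesis using regular_funs_outside[OF f] by simp
    qed
    ultimately show ?thesis by simp
  qed
  moreover have "regular_funs X \<noteq> {\<zero>\<^bsub>coord_ring X\<^esub>}"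
  proof
    assume "regular_funs X = {\<zero>\<^bsub>coord_ring X\<^esub>}"
    then have one: "restr X (\<lambda>_. 1) = (\<lambda>_. 0)"
      using regular_funs_const[OF X, of 1] by (simp add: coord_ring_def)
    obtain x where "x \<in> X" using neX by blast
    then show False using fun_cong[OF one, of x] by (simp add: restr_def)
  qed
  ultimately show ?thesis using \<eta> ideal_regular_funs[OF X] by blast
qed

end
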